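(* Assume that $A(t,\omega)$ is self-adjoint and that $f\in L^\alpha(\Omega;L^2((0,T);V^* ))$, $u_0\in L^\beta(\Omega;H)$, $A_{\min}^{-1}\in L^\gamma(\Omega;\mathbb R)$ for some exponents $\alpha,\beta,\gamma\ge1$ such that $$p:=\min\Big\{\frac{\alpha\gamma}{\alpha+\gamma},\ \frac{2\beta\gamma}{\beta+2\gamma}\Big\}>1 .$$ If moreover $$c_h:=\sup_{0\ne v_h\in V_h}\frac{\|v_h\|_{V^*}}{\|v_h\|_{V_h^*}}<\infty\ \text{ for all } h\qquad\text{and}\qquad \rho_{\max}:=\sup_{\omega\in\Omega}|\rho(\omega)|<\infty,$$ then $$\|u-u_h\|_{L^p(\Omega;\mathcal Y)}\le c_h(1+\rho_{\max})\,\mathbb E\Big[\inf_{y_h\in L^p(\Omega;\mathcal Y^h)}\|u-y_h\|_{\mathcal Y}^p\Big]^{1/p}.$$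
   Context: Let $T\in(0,\infty)$ and let $(\Omega,\Sigma,\mathbb P)$ be a complete probability space with normal filtration $(\Sigma_t)_{t\in[0,T]}$ and expectation $\mathbb E$. Let $V\subset H\subset V^*$ be a Gelfand triple of real separable Hilbert spaces, $V$ continuously and densely embedded in $H$, with dual pairing ${}_{V^*}\langle\cdot,\cdot\rangle_V$ extending the inner product $\langle\cdot,\cdot\rangle_H$. Let $A\colon[0,T]\times\Omega\to\mathcal L(V,V^* )$ be progressively measurable, $a(t,\omega;u,v):={}_{V^*}\langle A(t,\omega)u,v\rangle_V$, and assume there are random variables $A_{\min},A_{\max}$, positive and finite $\mathbb P$-a.s., such that for all $t\in[0,T]$, $u,v\in V$: $|a(t,\omega;u,v)|\le A_{\max}(\omega)\|u\|_V\|v\|_V$ and $a(t,\omega;v,v)\ge A_{\min}(\omega)\|v\|_V^2$. Put $\rho:=A_{\max}/A_{\min}$. Let $f$ be a progressively measurable $V^*$-valued process with $f(\cdot,\omega)\in L^2((0,T);V^* )$ and $u_0$ measurable with $u_0(\omega)\in H$. Infinite exponents are allowed, with the usual conventions. Let $\mathcal Y:=L^2((0,T);V)$ with its usual norm and $\mathcal X_{0,\{T\}}:=\{x\in L^2((0,T);V)\cap H^1((0,T);V^* ):x(T)=0\}$. Define $$\mathcal B^*_\omega(y,x):=\int_0^T\big({}_V\langle y(t),-\dot x(t)\rangle_{V^*}+a(t,\omega;y(t),x(t))\big)dt,\qquad \mathcal F_\omega(x):=\int_0^T{}_{V^*}\langle f(t,\omega),x(t)\rangle_V\,dt+\langle u_0(\omega),x(0)\rangle_H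 .$$ For a.e. $\omega$, $u=u(\cdot,\omega)\in\mathcal Y$ is the unique solution of $\mathcal B^*_\omega(u,x)=\mathcal F_\omega(x)$ for all $x\in\mathcal X_{0,\{T\}}$. Let $(V_h)_h$ be a family of nonzero finite-dimensional subspaces of $V$. For $v_h\in V_h$ put $\|v_h\|_{V^*}=\sup_{w\in V,\|w\|_V=1}\langle v_h,w\rangle_H$ and $\|v_h\|_{V_h^*}=\sup_{w_h\in V_h,\|w_h\|_V=1}\langle v_h,w_h\rangle_H$. Let $\mathcal Y^h:=L^2((0,T);V_h)$. For a.e. $\omega$, $u_h=u_h(\cdot,\omega)\in\mathcal Y^h$ is the unique solution of $\mathcal B^*_\omega(u_h,x_h)=\mathcal F_\omega(x_h)$ for all $x_h\in L^2((0,T);V_h)\cap H^1((0,T);V_h^* )$ with $x_h(T)=0$. The infimum inside the expectation is taken for each $\omega$, over $y_h=y_h(\omega)$ which may be chosen differently for each $\omega$. *)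

theory Defs
  imports "HOL-Probability.Probability"
begin

section \<open>The dual of a separable Hilbert space is separable\<close>

text \<open>Bochner integrals require a second countable codomain, so the dual \<open>'v \<Rightarrow>\<^sub>L real\<close> needs an
  instance of \<^class>\<open>second_countable_topology\<close>. It is obtained from the Riesz representation theorem
  and is stated for codomains in \<^class>\<open>euclidean_space\<close>, because a type arity cannot mention the
  fixed type \<^typ>\<open>real\<close>.\<close>

lemma riesz_representation:
  fixes \<phi> :: "'v::{real_inner, banach} \<Rightarrow>\<^sub>L real"
  obtains w where "\<And>v. blinfun_apply \<phi> v = w \<bullet> v"
proof -
  define J where "J v = v \<bullet> v - 2 * blinfun_apply \<phi> v" for v
  define m where "m = (INF v. J v)"
  have lower: "- (norm \<phi>)\<^sup>2 \<le> J v" for v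
  proof -
    have "blinfun_apply \<phi> v \<le> norm \<phi> * norm v"
      using norm_blinfun[of \<phi> v] by simp
    moreover have "0 \<le> (norm v - norm \<phi>)\<^sup>2" by simp
    ultimately show ?thesis
      unfolding J_def by (simp add: power2_diff power2_norm_eq_inner algebra_simps)
  qed
  have bdd: "bdd_below (range J)"
    by (rule bdd_belowI2[of UNIV _ J]) (use lower in auto)
  have m_le: "m \<le> J v" for v
    unfolding m_def by (rule cINF_lower[OF bdd]) simp
  have "\<exists>v. J v < m + 1 / (Suc n)" for n
  proof -
    have "(INF v. J v) < m + 1 / (Suc n)" unfolding m_def by simp
    then show ?thesis using cINF_less_iff[OF _ bdd] by auto
  qed
  then obtain s where s: "\<And>n. J (s n) < m + 1 / (Suc n)" by metis
  have par: "(norm (a - b))\<^sup>2 \<le> 2 * (J a - m) + 2 * (J b - m)" for a b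
  proof -
    have "J a + J b - 2 * J ((1/2) *\<^sub>R (a + b)) = (norm (a - b))\<^sup>2 / 2"
      unfolding J_def power2_norm_eq_inner
      by (simp add: inner_add inner_diff blinfun.add_right blinfun.scaleR_right inner_commute
          field_simps)
    with m_le[of "(1/2) *\<^sub>R (a + b)"] show ?thesis by (simp add: field_simps)
  qed
  have "Cauchy s"
  proof (rule metric_CauchyI)
    fix e :: real assume "e > 0"
    then obtain N where N: "inverse (real (Suc N)) < e\<^sup>2 / 4"
      using reals_Archimedean[of "e\<^sup>2 / 4"] by auto
    have small: "J (s n) - m < e\<^sup>2 / 4" if "n \<ge> N" for n
    proof -
      have "1 / real (Suc n) \<le> 1 / real (Suc N)"
        using that by (simp add: field_simps)
      with s[of n] N show ?thesis by (simp add: inverse_eq_divide)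
    qed
    show "\<exists>M. \<forall>i\<ge>M. \<forall>j\<ge>M. dist (s i) (s j) < e"
    proof (intro exI allI impI)
      fix i j assume "i \<ge> N" "j \<ge> N"
      then have "J (s i) - m < e\<^sup>2 / 4" "J (s j) - m < e\<^sup>2 / 4"
        using small by blast+
      then have "(norm (s i - s j))\<^sup>2 < e\<^sup>2"
        using par[of "s i" "s j"] by (simp add: field_simps)
      then show "dist (s i) (s j) < e"
        using \<open>e > 0\<close> by (simp add: dist_norm power2_less_imp_less)
    qed
  qed
  then obtain w where w: "s \<longlonglongrightarrow> w"
    using Cauchy_convergent convergent_def by blast
  have "(\<lambda>n. J (s n)) \<longlonglongrightarrow> J w"
    unfolding J_def by (intro tendsto_intros w)
  moreover have "(\<lambda>n. m + 1 / real (Suc n)) \<longlonglongrightarrow> m + 0"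
    by (intro tendsto_intros LIMSEQ_Suc[OF lim_1_over_n])
  ultimately have "J w \<le> m + 0"
    by (rule LIMSEQ_le) (use s less_imp_le in blast)
  then have min: "J w \<le> J v" for v using m_le[of v] by simp
  have "blinfun_apply \<phi> v = w \<bullet> v" for v
  proof (cases "v = 0")
    case False
    define d where "d = w \<bullet> v - blinfun_apply \<phi> v"
    define t where "t = - d / (v \<bullet> v)"
    have pos: "v \<bullet> v > 0" using False by simp
    have "J (w + t *\<^sub>R v) = J w + 2 * t * d + t\<^sup>2 * (v \<bullet> v)"
      unfolding J_def d_def
      by (simp add: inner_add inner_commute blinfun.add_right blinfun.scaleR_right power2_eq_square
          algebra_simps)
    also have "\<dots> = J w - d\<^sup>2 / (v \<bullet> v)"
      using pos unfolding t_def by (simp add: field_simps power2_eq_square)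
    finally have "d\<^sup>2 / (v \<bullet> v) \<le> 0" using min[of "w + t *\<^sub>R v"] by simp
    then have "d = 0" using pos by (simp add: divide_le_0_iff)
    then show ?thesis unfolding d_def by simp
  qed simp
  then show ?thesis by (rule that)
qed

instance blinfun :: ("{real_inner, banach, second_countable_topology}", euclidean_space)
  second_countable_topology
proof
  obtain C :: "'a set" where C: "countable C" "\<And>X. open X \<Longrightarrow> X \<noteq> {} \<Longrightarrow> \<exists>d\<in>C. d \<in> X"
    using countable_dense_setE by metis
  define G :: "('b \<Rightarrow> 'a) \<Rightarrow> 'a \<Rightarrow>\<^sub>L 'b"
    where "G d = (\<Sum>i\<in>Basis. blinfun_scaleR_left i o\<^sub>L blinfun_inner_right (d i))" for d
  define D where "D = G ` (PiE Basis (\<lambda>_. C))"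
  define B where "B = (\<lambda>(c, n). ball c (inverse (real (Suc n)))) ` (D \<times> (UNIV :: nat set))"
  have "countable D"
    unfolding D_def by (intro countable_image countable_PiE C) simp_all
  then have cB: "countable B" unfolding B_def by simp
  have dense: "\<exists>c\<in>D. dist \<phi> c < e" if "e > 0" for \<phi> :: "'a \<Rightarrow>\<^sub>L 'b" and e
  proof -
    have "\<exists>w. \<forall>v. blinfun_apply \<phi> v \<bullet> i = w \<bullet> v" for i
      using riesz_representation[of "blinfun_inner_right i o\<^sub>L \<phi>"]
      by (metis blinfun_apply_blinfun_compose blinfun_inner_right.rep_eq inner_commute)
    then obtain w where w: "\<And>i v. blinfun_apply \<phi> v \<bullet> i = w i \<bullet> v" by metis
    define \<delta> where "\<delta> = e / (2 * DIM('b))"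
    have "\<delta> > 0" using that by (simp add: \<delta>_def)
    then have "\<exists>c\<in>C. c \<in> ball (w i) \<delta>" for i by (intro C) auto
    then obtain c where c: "\<And>i. c i \<in> C" "\<And>i. dist (w i) (c i) < \<delta>" by (metis mem_ball)
    define d where "d = restrict c Basis"
    have "d \<in> PiE Basis (\<lambda>_. C)" unfolding d_def using c by auto
    then have "G d \<in> D" unfolding D_def by blast
    moreover have "dist \<phi> (G d) \<le> e / 2"
      unfolding dist_norm
    proof (rule norm_blinfun_bound)
      fix v
      have "blinfun_apply (\<phi> - G d) v = (\<Sum>i\<in>Basis. ((w i - d i) \<bullet> v) *\<^sub>R i)"
      proof -
        have "blinfun_apply \<phi> v = (\<Sum>i\<in>Basis. (w i \<bullet> v) *\<^sub>R i)"
          using euclidean_representation[of "blinfun_apply \<phi> v"] by (simp add: w)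
        moreover have "blinfun_apply (G d) v = (\<Sum>i\<in>Basis. (d i \<bullet> v) *\<^sub>R i)"
          by (simp add: G_def blinfun.sum_left)
        ultimately show ?thesis
          by (simp add: blinfun.diff_left inner_diff_left scaleR_left_diff_distrib sum_subtractf)
      qed
      also have "norm \<dots> \<le> (\<Sum>i\<in>(Basis :: 'b set). \<delta> * norm v)"
      proof (rule sum_norm_le)
        fix i :: 'b assume i: "i \<in> Basis"
        have "\<bar>(w i - d i) \<bullet> v\<bar> \<le> norm (w i - d i) * norm v" by (rule Cauchy_Schwarz_ineq2)
        also have "\<dots> \<le> \<delta> * norm v"
          using c(2)[of i] i by (intro mult_right_mono) (auto simp: d_def dist_norm)
        finally show "norm (((w i - d i) \<bullet> v) *\<^sub>R i) \<le> \<delta> * norm v" using i by simp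
      qed
      also have "\<dots> = e / 2 * norm v" by (simp add: \<delta>_def)
      finally show "norm (blinfun_apply (\<phi> - G d) v) \<le> e / 2 * norm v" .
    qed (use that in simp)
    ultimately show ?thesis using that by (intro bexI[of _ "G d"]) auto
  qed
  have "topological_basis B"
  proof (rule topological_basisI)
    show "open U" if "U \<in> B" for U using that unfolding B_def by auto
    fix U :: "('a \<Rightarrow>\<^sub>L 'b) set" and x assume U: "open U" "x \<in> U"
    then obtain e where e: "e > 0" "ball x e \<subseteq> U" using open_contains_ball by blast
    obtain n where n: "inverse (real (Suc n)) < e / 2" using reals_Archimedean[of "e/2"] e by auto
    obtain c where c: "c \<in> D" "dist x c < inverse (real (Suc n))"
      using dense[of "inverse (real (Suc n))" x] by auto
    have "ball c (inverse (real (Suc n))) \<subseteq> ball x e"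
    proof
      fix y assume "y \<in> ball c (inverse (real (Suc n)))"
      then have "dist c y < inverse (real (Suc n))" by simp
      then have "dist x y < e" using dist_triangle[of x y c] c n by linarith
      then show "y \<in> ball x e" by simp
    qed
    with c e show "\<exists>B'\<in>B. x \<in> B' \<and> B' \<subseteq> U"
      by (intro bexI[of _ "ball c (inverse (real (Suc n)))"])
        (auto simp: B_def dist_commute)
  qed
  then show "\<exists>B::('a \<Rightarrow>\<^sub>L 'b) set set. countable B \<and> open = generate_topology B"
    using cB topological_basis_imp_subbasis by blast
qed


section \<open>Gelfand triples\<close>

text \<open>\<open>V \<subset> H\<close> is rendered by an injection \<open>\<iota>\<close>, and \<open>V\<^sup>*\<close> is the type \<open>'v \<Rightarrow>\<^sub>L real\<close>. The map
  \<open>dual_embed \<iota>\<close> is the resulting inclusion of \<open>H\<close> into \<open>V\<^sup>*\<close>, i.e. the dual pairing extends the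
  inner product of \<open>H\<close>.\<close>

definition gelfand_embedding ::
    "('v::{real_inner,banach} \<Rightarrow>\<^sub>L 'h::{real_inner,banach}) \<Rightarrow> bool" where
  "gelfand_embedding \<iota> \<longleftrightarrow> inj (blinfun_apply \<iota>) \<and> closure (range (blinfun_apply \<iota>)) = UNIV"

definition dual_embed ::
    "('v::{real_inner,banach} \<Rightarrow>\<^sub>L 'h::{real_inner,banach}) \<Rightarrow> 'h \<Rightarrow> ('v \<Rightarrow>\<^sub>L real)" where
  "dual_embed \<iota> z = blinfun_inner_right z o\<^sub>L \<iota>"

definition dual_norm_on ::
    "('v::{real_inner,banach} \<Rightarrow>\<^sub>L 'h::{real_inner,banach}) \<Rightarrow> 'v set \<Rightarrow> 'v \<Rightarrow> real" where
  "dual_norm_on \<iota> W v = (SUP w\<in>{w \<in> W. norm w = 1}. blinfun_apply \<iota> v \<bullet> blinfun_apply \<iota> w)"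

definition dual_norm_ratio ::
    "('v::{real_inner,banach} \<Rightarrow>\<^sub>L 'h::{real_inner,banach}) \<Rightarrow> 'v set \<Rightarrow> ennreal" where
  "dual_norm_ratio \<iota> W =
     (SUP v\<in>W - {0}. ennreal (dual_norm_on \<iota> UNIV v / dual_norm_on \<iota> W v))"


section \<open>Lebesgue--Bochner spaces\<close>

definition epowr :: "ennreal \<Rightarrow> real \<Rightarrow> ennreal" where
  "epowr x r = (if x = \<top> then \<top> else ennreal (enn2real x powr r))"

text \<open>The essential supremum is written as \<^const>\<open>Limsup\<close> along the almost-everywhere filter, which
  is what \<^const>\<open>esssup\<close> unfolds to on measurable functions.\<close>

definition Lp_norm :: "'a measure \<Rightarrow> ennreal \<Rightarrow> ('a \<Rightarrow> ennreal) \<Rightarrow> ennreal" where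
  "Lp_norm M p X =
     (if p = \<top> then Limsup (ae_filter M) X
      else epowr (\<integral>\<^sup>+\<omega>. epowr (X \<omega>) (enn2real p) \<partial>M) (1 / enn2real p))"

text \<open>Strong measurability of an \<open>S\<close>-valued map, where the normed space \<open>S\<close> is given as a
  set with a (semi)norm \<open>N\<close>; in particular \<open>S\<close> may be a space of functions of time.\<close>

definition strongly_measurable ::
    "'a measure \<Rightarrow> ('b::minus \<Rightarrow> ennreal) \<Rightarrow> 'b set \<Rightarrow> ('a \<Rightarrow> 'b) \<Rightarrow> bool" where
  "strongly_measurable M N S X \<longleftrightarrow>
     (\<exists>s :: nat \<Rightarrow> 'a \<Rightarrow> 'b.
        (\<forall>n. simple_function M (s n) \<and> (\<forall>\<omega>\<in>space M. s n \<omega> \<in> S)) \<and>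
        (AE \<omega> in M. (\<lambda>n. N (X \<omega> - s n \<omega>)) \<longlonglongrightarrow> 0))"

definition Lp_space ::
    "'a measure \<Rightarrow> ennreal \<Rightarrow> ('b::minus \<Rightarrow> ennreal) \<Rightarrow> 'b set \<Rightarrow> ('a \<Rightarrow> 'b) set" where
  "Lp_space M p N S =
     {X. (\<forall>\<omega>\<in>space M. X \<omega> \<in> S) \<and> strongly_measurable M N S X \<and> Lp_norm M p (\<lambda>\<omega>. N (X \<omega>)) < \<top>}"

definition time_measure :: "real \<Rightarrow> real measure" where
  "time_measure T = restrict_space lborel {0<..<T}"

text \<open>\<open>L\<^sup>2((0,T);W)\<close> for a linear space \<open>W\<close> normed by \<open>N\<close>. Elements are functions rather than
  classes; the values outside \<open>(0,T)\<close> and on null sets are immaterial, and every class has a Borel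
  measurable representative.\<close>

definition L2_space ::
    "real \<Rightarrow> ('e::real_normed_vector \<Rightarrow> real) \<Rightarrow> 'e set \<Rightarrow> (real \<Rightarrow> 'e) set" where
  "L2_space T N W =
     {y \<in> borel_measurable (time_measure T).
        (AE t in time_measure T. y t \<in> W) \<and>
        (\<integral>\<^sup>+t. ennreal ((N (y t))\<^sup>2) \<partial>time_measure T) < \<top>}"

definition L2_norm :: "real \<Rightarrow> (real \<Rightarrow> 'e::real_normed_vector) \<Rightarrow> ennreal" where
  "L2_norm T y = epowr (\<integral>\<^sup>+t. ennreal ((norm (y t))\<^sup>2) \<partial>time_measure T) (1/2)"

text \<open>\<open>C\<^sub>c\<^sup>\<infinity>(0,T)\<close>, extended by zero to the real line.\<close>

definition test_functions :: "real \<Rightarrow> (real \<Rightarrow> real) set" where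
  "test_functions T =
     {\<phi>. (\<forall>n t. (deriv ^^ n) \<phi> differentiable (at t)) \<and>
          (\<exists>a b. 0 < a \<and> b < T \<and> (\<forall>t. t \<notin> {a..b} \<longrightarrow> \<phi> t = 0))}"

definition weak_time_deriv ::
    "real \<Rightarrow> (real \<Rightarrow> 'e::{banach,second_countable_topology}) \<Rightarrow> (real \<Rightarrow> 'e) \<Rightarrow> bool" where
  "weak_time_deriv T x g \<longleftrightarrow>
     (\<forall>\<phi>\<in>test_functions T.
        (\<integral>t. deriv \<phi> t *\<^sub>R x t \<partial>time_measure T) = - (\<integral>t. \<phi> t *\<^sub>R g t \<partial>time_measure T))"


section \<open>Weak space-time formulation\<close>

text \<open>A member \<open>x\<close> of \<open>L\<^sup>2((0,T);V) \<inter> H\<^sup>1((0,T);V\<^sup>*)\<close> is listed together with its weak derivative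
  \<open>dx\<close>, taken in \<open>V\<^sup>*\<close>, and its representative \<open>xc\<close> in \<open>C([0,T];H)\<close>, which gives meaning to
  \<open>x(0)\<close> and \<open>x(T)\<close>. Both are determined by \<open>x\<close> (\<open>dx\<close> up to null sets, \<open>xc\<close> on \<open>[0,T]\<close>).\<close>

definition adjoint_test_space ::
    "real \<Rightarrow> ('v::{real_inner,banach,second_countable_topology} \<Rightarrow>\<^sub>L 'h::{real_inner,banach})
      \<Rightarrow> ((real \<Rightarrow> 'v) \<times> (real \<Rightarrow> 'v \<Rightarrow>\<^sub>L real) \<times> (real \<Rightarrow> 'h)) set" where
  "adjoint_test_space T \<iota> =
     {(x, dx, xc).
        x \<in> L2_space T norm UNIV \<and> dx \<in> L2_space T norm UNIV \<and>
        weak_time_deriv T (\<lambda>t. dual_embed \<iota> (blinfun_apply \<iota> (x t))) dx \<and>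
        continuous_on {0..T} xc \<and> (AE t in time_measure T. blinfun_apply \<iota> (x t) = xc t) \<and>
        xc T = 0}"

text \<open>The discrete analogue for \<open>W = V\<^sub>h\<close>. Here \<open>V\<^sub>h\<^sup>*\<close> is the set \<open>W\<close> with the norm
  \<open>dual_norm_on \<iota> W\<close>, so that \<open>dx\<close> is \<open>W\<close>-valued; its pairing with \<open>W\<close> is the inner product of \<open>H\<close>.
  The weak derivative may be computed in \<open>V\<close>, as all norms on \<open>W\<close> are equivalent.\<close>

definition discrete_test_space ::
    "real \<Rightarrow> ('v::{real_inner,banach,second_countable_topology} \<Rightarrow>\<^sub>L 'h::{real_inner,banach})
      \<Rightarrow> 'v set \<Rightarrow> ((real \<Rightarrow> 'v) \<times> (real \<Rightarrow> 'v) \<times> (real \<Rightarrow> 'h)) set" where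
  "discrete_test_space T \<iota> W =
     {(x, dx, xc).
        x \<in> L2_space T norm W \<and> dx \<in> L2_space T (dual_norm_on \<iota> W) W \<and>
        weak_time_deriv T x dx \<and>
        continuous_on {0..T} xc \<and> (AE t in time_measure T. blinfun_apply \<iota> (x t) = xc t) \<and>
        xc T = 0}"

definition adjoint_form ::
    "real \<Rightarrow> (real \<Rightarrow> 'v::{real_inner,banach,second_countable_topology} \<Rightarrow>\<^sub>L ('v \<Rightarrow>\<^sub>L real))
      \<Rightarrow> (real \<Rightarrow> 'v) \<Rightarrow> (real \<Rightarrow> 'v) \<Rightarrow> (real \<Rightarrow> 'v \<Rightarrow>\<^sub>L real) \<Rightarrow> real" where
  "adjoint_form T A y x dx =
     (\<integral>t. blinfun_apply (- dx t) (y t) + blinfun_apply (blinfun_apply (A t) (y t)) (x t)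
        \<partial>time_measure T)"

definition load_functional ::
    "real \<Rightarrow> (real \<Rightarrow> 'v::{real_inner,banach,second_countable_topology} \<Rightarrow>\<^sub>L real)
      \<Rightarrow> 'h::{real_inner,banach} \<Rightarrow> (real \<Rightarrow> 'v) \<Rightarrow> (real \<Rightarrow> 'h) \<Rightarrow> real" where
  "load_functional T f u0 x xc = (\<integral>t. blinfun_apply (f t) (x t) \<partial>time_measure T) + u0 \<bullet> xc 0"

definition weak_solution ::
    "real \<Rightarrow> ('v::{real_inner,banach,second_countable_topology} \<Rightarrow>\<^sub>L 'h::{real_inner,banach})
      \<Rightarrow> (real \<Rightarrow> 'v \<Rightarrow>\<^sub>L ('v \<Rightarrow>\<^sub>L real)) \<Rightarrow> (real \<Rightarrow> 'v \<Rightarrow>\<^sub>L real) \<Rightarrow> 'h \<Rightarrow> (real \<Rightarrow> 'v) \<Rightarrow> bool" where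
  "weak_solution T \<iota> A f u0 u \<longleftrightarrow>
     u \<in> L2_space T norm UNIV \<and>
     (\<forall>(x, dx, xc)\<in>adjoint_test_space T \<iota>.
        adjoint_form T A u x dx = load_functional T f u0 x xc)"

definition discrete_solution ::
    "real \<Rightarrow> ('v::{real_inner,banach,second_countable_topology} \<Rightarrow>\<^sub>L 'h::{real_inner,banach})
      \<Rightarrow> (real \<Rightarrow> 'v \<Rightarrow>\<^sub>L ('v \<Rightarrow>\<^sub>L real)) \<Rightarrow> (real \<Rightarrow> 'v \<Rightarrow>\<^sub>L real) \<Rightarrow> 'h \<Rightarrow> 'v set \<Rightarrow> (real \<Rightarrow> 'v)
      \<Rightarrow> bool" where
  "discrete_solution T \<iota> A f u0 W u \<longleftrightarrow>
     u \<in> L2_space T norm W \<and>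
     (\<forall>(x, dx, xc)\<in>discrete_test_space T \<iota> W.
        adjoint_form T A u x (\<lambda>t. dual_embed \<iota> (blinfun_apply \<iota> (dx t)))
          = load_functional T f u0 x xc)"


section \<open>Stochastic setting\<close>

definition normal_filtration :: "'w measure \<Rightarrow> real \<Rightarrow> (real \<Rightarrow> 'w measure) \<Rightarrow> bool" where
  "normal_filtration M T F \<longleftrightarrow>
     (\<forall>t\<in>{0..T}. subalgebra M (F t)) \<and>
     (\<forall>s\<in>{0..T}. \<forall>t\<in>{0..T}. s \<le> t \<longrightarrow> sets (F s) \<subseteq> sets (F t)) \<and>
     (\<forall>t\<in>{0..<T}. sets (F t) = (\<Inter>s\<in>{t<..T}. sets (F s))) \<and>
     null_sets M \<subseteq> sets (F 0)"

definition progressively_measurable ::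
    "real \<Rightarrow> (real \<Rightarrow> 'w measure) \<Rightarrow> (real \<Rightarrow> 'w \<Rightarrow> 'e::topological_space) \<Rightarrow> bool" where
  "progressively_measurable T F X \<longleftrightarrow>
     (\<forall>t\<in>{0..T}. (\<lambda>(s, \<omega>). X s \<omega>)
        \<in> borel_measurable (restrict_space borel {0..t} \<Otimes>\<^sub>M F t))"

text \<open>\<open>a b / (a + b)\<close>, extended to infinite exponents by its limit.\<close>

definition exponent_quotient :: "ennreal \<Rightarrow> ennreal \<Rightarrow> ennreal" where
  "exponent_quotient a b = (if a = \<top> then b else if b = \<top> then a else a * b / (a + b))"

text \<open>\<open>\<bbbE>[inf \<parallel>u - y\<parallel>\<^sup>p]\<close> to the power \<open>1/p\<close>, where \<open>y\<close> ranges over \<open>L\<^sup>p(\<Omega>;Y)\<close> and the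
  infimum is taken separately for each \<open>\<omega>\<close>; for \<open>p = \<infinity>\<close> the essential supremum of the infimum.\<close>

definition expected_best_error ::
    "'w measure \<Rightarrow> ennreal \<Rightarrow> real \<Rightarrow> (real \<Rightarrow> 'v::real_normed_vector) set
      \<Rightarrow> ('w \<Rightarrow> real \<Rightarrow> 'v) \<Rightarrow> ennreal" where
  "expected_best_error M p T Y u =
     (if p = \<top> then
        Limsup (ae_filter M) (\<lambda>\<omega>. INF y\<in>Lp_space M p (L2_norm T) Y. L2_norm T (u \<omega> - y \<omega>))
      else
        epowr (\<integral>\<^sup>+\<omega>. (INF y\<in>Lp_space M p (L2_norm T) Y.
                 epowr (L2_norm T (u \<omega> - y \<omega>)) (enn2real p)) \<partial>M)
          (1 / enn2real p))"

end

theory Submission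
  imports Defs
begin

text \<open>Fix \<open>\<omega>\<close>, let \<open>e = u - u\<^sub>h\<close>, and let \<open>z = y\<^sub>h - u\<^sub>h\<close> for some \<open>y\<^sub>h\<close> in the discrete space. Let
  \<open>x\<close> solve the discrete backward problem \<open>- \<langle>x', w\<rangle>\<^sub>H + a(w, x) = (z, w)\<^sub>V\<close> for all
  \<open>w \<in> V\<^sub>h\<close>, with \<open>x(T) = 0\<close>. By Galerkin orthogonality, \<open>\<parallel>z\<parallel>\<^sup>2\<close> is the
  adjoint form at \<open>(z - s e, x)\<close> for every real \<open>s\<close>. Since \<open>a\<close> is symmetric, maximal regularity in
  the energy norm bounds \<open>x'\<close> and \<open>x\<close> jointly; this gives \<open>\<parallel>z\<parallel> \<le> K \<parallel>z - s e\<parallel>\<close> with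
  \<open>K\<^sup>2 = c\<^sub>h\<^sup>2 \<rho> + \<rho>\<^sup>2 \<le> c\<^sub>h\<^sup>2 (1 + \<rho>)\<^sup>2\<close>. Choosing \<open>s = \<parallel>z\<parallel>\<^sup>2 / \<parallel>e\<parallel>\<^sup>2\<close> turns this into
  \<open>\<parallel>e\<parallel> \<le> K \<parallel>e - z\<parallel> = K \<parallel>u - y\<^sub>h\<parallel>\<close>, and it remains to take norms over \<open>\<Omega>\<close>.\<close>

section \<open>Tail integrals on the time interval\<close>

lemma space_time_measure [simp]: "space (time_measure T) = {0<..<T}"
  by (simp add: time_measure_def space_restrict_space)

lemma sets_time_measure: "sets (time_measure T) = sets (restrict_space borel {0<..<T})"
  by (simp add: time_measure_def sets_restrict_space)

lemma borel_measurable_time_measure [measurable (raw)]: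
  "f \<in> borel_measurable borel \<Longrightarrow> f \<in> borel_measurable (time_measure T)"
  by (simp add: time_measure_def measurable_restrict_space1)

lemma finite_measure_time_measure: "finite_measure (time_measure T)"
proof (rule finite_measureI)
  have "emeasure (time_measure T) {0<..<T} = emeasure lborel {0<..<T}"
    unfolding time_measure_def by (subst emeasure_restrict_space) auto
  also have "\<dots> \<noteq> \<infinity>"
    by (cases "0 \<le> T") auto
  finally show "emeasure (time_measure T) (space (time_measure T)) \<noteq> \<infinity>" by simp
qed

interpretation time: finite_measure "time_measure T" for T
  by (rule finite_measure_time_measure)

interpretation time_pair: pair_sigma_finite "time_measure T" "time_measure T" for T ..

lemma AE_time_measure: "AE t in time_measure T. 0 < t \<and> t < T"
  by (rule AE_I2) simp

lemma AE_time_measure_neq: "AE s in time_measure T. s \<noteq> t"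
proof -
  have "AE s in lborel. s \<noteq> t" by (rule AE_lborel_singleton)
  then show ?thesis
    unfolding time_measure_def by (subst AE_restrict_space_iff) auto
qed

lemma continuous_norm_bound_Ioo:
  fixes x :: "real \<Rightarrow> 'a::real_normed_vector"
  assumes "continuous_on UNIV x"
  obtains R where "\<And>t. 0 < t \<Longrightarrow> t < T \<Longrightarrow> norm (x t) \<le> R"
proof -
  have "compact (x ` {0..T})"
    by (rule compact_continuous_image[OF continuous_on_subset[OF assms]]) auto
  then obtain R where "\<forall>y\<in>x ` {0..T}. norm y \<le> R"
    using compact_imp_bounded bounded_iff by metis
  then show ?thesis using that[of R] by simp
qed

text \<open>The solution of x' = -k with x(T) = 0. Encoding the interval of integration by an
  indicator yields a function on the whole line, constant on the negative half-line and zero from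
  \<open>T\<close> on.\<close>

definition tail_integral :: "real \<Rightarrow> (real \<Rightarrow> 'a::{banach,second_countable_topology}) \<Rightarrow> real \<Rightarrow> 'a"
  where "tail_integral T k t = (\<integral>s. indicator {t<..} s *\<^sub>R k s \<partial>time_measure T)"

lemma integrable_indicator_time:
  fixes k :: "real \<Rightarrow> 'a::{banach,second_countable_topology}"
  assumes "integrable (time_measure T) k"
  shows "integrable (time_measure T) (\<lambda>s. indicator {t<..} s *\<^sub>R k s)"
proof (rule Bochner_Integration.integrable_bound[OF assms])
  show "(\<lambda>s. indicator {t<..} s *\<^sub>R k s) \<in> borel_measurable (time_measure T)"
    using assms by measurable
qed (auto simp: indicator_def)

lemma tail_integral_end: "tail_integral T k T = 0"
proof -
  have "(\<integral>s. indicator {T<..} s *\<^sub>R k s \<partial>time_measure T) = (\<integral>s. 0 \<partial>time_measure T)"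
    by (rule Bochner_Integration.integral_cong) auto
  then show ?thesis unfolding tail_integral_def by simp
qed

text \<open>Dominated convergence with majorant \<open>norm (k s)\<close>: along \<open>X n\<close>
  the indicators are eventually constant at every \<open>s\<close> other than the limit
  point.\<close>

lemma continuous_on_tail_integral:
  assumes k: "integrable (time_measure T) k"
  shows "continuous_on A (tail_integral T k)"
proof (rule continuous_on_subset[OF _ subset_UNIV], unfold continuous_on_sequentially, intro ballI allI impI)
  fix X :: "nat \<Rightarrow> real" and a :: real
  assume "(\<forall>n. X n \<in> UNIV) \<and> X \<longlonglongrightarrow> a"
  then have X: "X \<longlonglongrightarrow> a" by simp
  show "(tail_integral T k \<circ> X) \<longlonglongrightarrow> tail_integral T k a"
    unfolding tail_integral_def comp_def
  proof (rule integral_dominated_convergence[where w = "\<lambda>s. norm (k s)"])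
    show "AE s in time_measure T.
        (\<lambda>n. indicator {X n<..} s *\<^sub>R k s) \<longlonglongrightarrow> indicator {a<..} s *\<^sub>R k s"
      using AE_time_measure_neq[of a]
    proof eventually_elim
      case (elim s)
      have "\<forall>\<^sub>F n in sequentially. (indicator {X n<..} s :: real) = indicator {a<..} s"
      proof (cases "s < a")
        case True
        with order_tendstoD(1)[OF X] show ?thesis by (fastforce elim: eventually_mono)
      next
        case False
        with elim have "a < s" by simp
        with order_tendstoD(2)[OF X] show ?thesis by (fastforce elim: eventually_mono)
      qed
      then have "\<forall>\<^sub>F n in sequentially. indicator {X n<..} s *\<^sub>R k s = indicator {a<..} s *\<^sub>R k s"
        by eventually_elim simp
      then show ?case by (rule tendsto_eventually)
    qed
    show "integrable (time_measure T) (\<lambda>s. norm (k s))" using k by simp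
  qed (use k in \<open>auto simp: indicator_def\<close>)
qed

lemma bounded_linear_tail_integral:
  assumes "bounded_linear L" "integrable (time_measure T) k"
  shows "tail_integral T (\<lambda>s. L (k s)) t = L (tail_integral T k t)"
  unfolding tail_integral_def
  using integral_bounded_linear[OF assms(1) integrable_indicator_time[OF assms(2)]]
  by (simp add: linear_simps(5)[OF assms(1)])

text \<open>The integral acts only on the scalar coefficients of finitely many fixed vectors, so the
  value is a finite linear combination of members of \<open>W\<close>.\<close>

lemma tail_integral_in_subspace:
  fixes b :: "'i \<Rightarrow> 'a::{banach,second_countable_topology}"
  assumes "finite I" "\<And>i. i \<in> I \<Longrightarrow> integrable (time_measure T) (k i)" "\<And>i. i \<in> I \<Longrightarrow> b i \<in> W" "subspace W"
  shows "tail_integral T (\<lambda>s. \<Sum>i\<in>I. k i s *\<^sub>R b i) t \<in> W"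
proof -
  have "tail_integral T (\<lambda>s. \<Sum>i\<in>I. k i s *\<^sub>R b i) t
      = (\<integral>s. (\<Sum>i\<in>I. (indicator {t<..} s *\<^sub>R k i s) *\<^sub>R b i) \<partial>time_measure T)"
    unfolding tail_integral_def by (simp add: scaleR_sum_right)
  also have "\<dots> = (\<Sum>i\<in>I. \<integral>s. (indicator {t<..} s *\<^sub>R k i s) *\<^sub>R b i \<partial>time_measure T)"
    by (intro Bochner_Integration.integral_sum integrable_scaleR_left integrable_indicator_time assms)
  also have "\<dots> = (\<Sum>i\<in>I. tail_integral T (k i) t *\<^sub>R b i)"
    unfolding tail_integral_def
    by (intro sum.cong refl integral_scaleR_left integrable_indicator_time assms)
  also have "\<dots> \<in> W"
    using assms by (intro subspace_sum subspace_scale) auto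
  finally show ?thesis .
qed

text \<open>Domination by a product of integrable functions gives the joint integrability that
  Fubini requires for the triangular kernels below.\<close>

lemma integrable_time_product:
  fixes k :: "real \<Rightarrow> 'a::{banach,second_countable_topology}" and l :: "real \<Rightarrow> 'b::{banach,second_countable_topology}"
    and G :: "real \<times> real \<Rightarrow> 'c::{banach,second_countable_topology}"
  assumes k: "integrable (time_measure T) k" and l: "integrable (time_measure T) l"
    and G: "G \<in> borel_measurable (time_measure T \<Otimes>\<^sub>M time_measure T)"
    and bound: "\<And>t s. norm (G (t, s)) \<le> norm (k t) * norm (l s)"
  shows "integrable (time_measure T \<Otimes>\<^sub>M time_measure T) G"
proof (rule Bochner_Integration.integrable_bound[OF _ G])
  have [measurable]: "k \<in> borel_measurable (time_measure T)" "l \<in> borel_measurable (time_measure T)"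
    using k l by auto
  show "integrable (time_measure T \<Otimes>\<^sub>M time_measure T) (\<lambda>(t, s). norm (k t) * norm (l s))"
    by (rule time_pair.Fubini_integrable) (use k l in auto)
  show "AE p in time_measure T \<Otimes>\<^sub>M time_measure T. norm (G p) \<le> norm (case p of (t, s) \<Rightarrow> norm (k t) * norm (l s))"
    using bound by auto
qed

text \<open>With x the tail integral, the integrand is formally the derivative of -|x|^2 / 2.
  Instead of differentiating, the proof splits the time square into two triangles, which contribute
  equally because the inner product is symmetric. Stability uses that the right side is
  nonnegative.\<close>

lemma integral_inner_tail_integral:
  fixes k :: "real \<Rightarrow> 'h::{real_inner,banach,second_countable_topology}"
  assumes k: "integrable (time_measure T) k"
  shows "(\<integral>t. k t \<bullet> tail_integral T k t \<partial>time_measure T) = (norm (\<integral>t. k t \<partial>time_measure T))\<^sup>2 / 2"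
proof -
  let ?M = "time_measure T"
  have [measurable]: "k \<in> borel_measurable ?M" using k by auto
  have [measurable]: "(\<lambda>t. t) \<in> borel_measurable ?M" by simp
  \<comment> \<open>\<open>G\<close> lives on the triangle t < s and \<open>G'\<close> on s < t;
    together they miss only the diagonal.\<close>
  define G where "G = (\<lambda>t s. indicator {t<..} s * (k t \<bullet> k s))"
  define G' where "G' = (\<lambda>t s. indicator {s<..} t * (k t \<bullet> k s))"
  have [measurable]: "(\<lambda>p. if fst p < snd p then 1 else 0 :: real) \<in> borel_measurable (?M \<Otimes>\<^sub>M ?M)"
    "(\<lambda>p. if snd p < fst p then 1 else 0 :: real) \<in> borel_measurable (?M \<Otimes>\<^sub>M ?M)"
    by measurable
  have "case_prod G = (\<lambda>p. (if fst p < snd p then 1 else 0) * (k (fst p) \<bullet> k (snd p)))"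
    "case_prod G' = (\<lambda>p. (if snd p < fst p then 1 else 0) * (k (fst p) \<bullet> k (snd p)))"
    by (auto simp: G_def G'_def indicator_def)
  then have [measurable]: "case_prod G \<in> borel_measurable (?M \<Otimes>\<^sub>M ?M)" "case_prod G' \<in> borel_measurable (?M \<Otimes>\<^sub>M ?M)"
    by simp_all
  have G: "integrable (?M \<Otimes>\<^sub>M ?M) (case_prod G)"
    by (rule integrable_time_product[OF k k])
      (auto simp: G_def indicator_def abs_mult Cauchy_Schwarz_ineq2 split: split_indicator)
  have G': "integrable (?M \<Otimes>\<^sub>M ?M) (case_prod G')"
    by (rule integrable_time_product[OF k k])
      (auto simp: G'_def indicator_def abs_mult Cauchy_Schwarz_ineq2 split: split_indicator)
  have inner: "(\<integral>s. G t s \<partial>?M) = k t \<bullet> tail_integral T k t" for t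
    unfolding G_def tail_integral_def
    by (subst integral_inner_right[symmetric])
       (auto intro!: integrable_indicator_time k)
  have "(\<integral>t. (\<integral>s. G' t s \<partial>?M) \<partial>?M) = (\<integral>s. (\<integral>t. G' t s \<partial>?M) \<partial>?M)"
    by (rule time_pair.Fubini_integral[symmetric]) (use G' in \<open>simp add: case_prod_eta\<close>)
  also have "\<dots> = (\<integral>s. (\<integral>t. G s t \<partial>?M) \<partial>?M)"
    by (simp add: G_def G'_def inner_commute)
  finally have swap: "(\<integral>t. (\<integral>s. G' t s \<partial>?M) \<partial>?M) = (\<integral>t. (\<integral>s. G t s \<partial>?M) \<partial>?M)" .
  have "(norm (\<integral>t. k t \<partial>?M))\<^sup>2 = (\<integral>t. k t \<bullet> (\<integral>s. k s \<partial>?M) \<partial>?M)"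
    using k by (simp add: power2_norm_eq_inner)
  also have "\<dots> = (\<integral>t. (\<integral>s. G t s \<partial>?M) + (\<integral>s. G' t s \<partial>?M) \<partial>?M)"
  proof (rule integral_cong_AE)
    show "(\<lambda>t. k t \<bullet> (\<integral>s. k s \<partial>?M)) \<in> borel_measurable ?M" by simp
    show "(\<lambda>t. (\<integral>s. G t s \<partial>?M) + (\<integral>s. G' t s \<partial>?M)) \<in> borel_measurable ?M"
      by measurable
    show "AE t in ?M. k t \<bullet> (\<integral>s. k s \<partial>?M) = (\<integral>s. G t s \<partial>?M) + (\<integral>s. G' t s \<partial>?M)"
      using time_pair.AE_integrable_fst[OF G] time_pair.AE_integrable_fst[OF G']
    proof eventually_elim
      case (elim t)
      have "k t \<bullet> (\<integral>s. k s \<partial>?M) = (\<integral>s. k t \<bullet> k s \<partial>?M)"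
        using k by simp
      also have "\<dots> = (\<integral>s. G t s + G' t s \<partial>?M)"
      proof (rule integral_cong_AE)
        show "(\<lambda>s. G t s + G' t s) \<in> borel_measurable ?M"
          using elim by auto
        show "AE s in ?M. k t \<bullet> k s = G t s + G' t s"
          using AE_time_measure_neq[of t] by eventually_elim (auto simp: G_def G'_def indicator_def)
      qed simp
      also have "\<dots> = (\<integral>s. G t s \<partial>?M) + (\<integral>s. G' t s \<partial>?M)"
        using elim by simp
      finally show ?case .
    qed
  qed
  also have "\<dots> = 2 * (\<integral>t. (\<integral>s. G t s \<partial>?M) \<partial>?M)"
    using time_pair.integrable_fst[OF G] time_pair.integrable_fst[OF G'] swap by simp
  finally show ?thesis by (simp add: inner)
qed

section \<open>Weak derivatives\<close>

lemma test_function_facts: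
  assumes "\<phi> \<in> test_functions T"
  shows "continuous_on UNIV (deriv \<phi>)" "(\<phi> has_real_derivative deriv \<phi> t) (at t)" "\<phi> 0 = 0"
proof -
  have d: "(deriv ^^ n) \<phi> differentiable (at t)" for n t
    using assms unfolding test_functions_def by blast
  have "deriv \<phi> differentiable (at t)" for t
    using d[of 1 t] by simp
  then show "continuous_on UNIV (deriv \<phi>)"
    by (intro continuous_at_imp_continuous_on ballI differentiable_imp_continuous_within)
  show "(\<phi> has_real_derivative deriv \<phi> t) (at t)"
    using d[of 0 t] by (simp add: DERIV_deriv_iff_real_differentiable)
  show "\<phi> 0 = 0"
    using assms unfolding test_functions_def by fastforce
qed

text \<open>The inner integral of the Fubini argument for weak derivatives: as a function of
  \<open>t\<close> the indicator selects the interval (0,s), where the fundamental theorem of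
  calculus applies.\<close>

lemma integral_deriv_time_measure:
  assumes "0 < s" "s < T" and \<phi>: "continuous_on UNIV (deriv \<phi>)"
    "\<And>t. (\<phi> has_real_derivative deriv \<phi> t) (at t)"
  shows "(\<integral>t. indicator {t<..} s * deriv \<phi> t \<partial>time_measure T) = \<phi> s - \<phi> 0"
proof -
  have [measurable]: "deriv \<phi> \<in> borel_measurable borel"
    using \<phi>(1) by (rule borel_measurable_continuous_onI)
  have "(\<integral>t. indicator {t<..} s * deriv \<phi> t \<partial>time_measure T)
      = (\<integral>t. indicator {0<..<T} t *\<^sub>R (indicator {t<..} s * deriv \<phi> t) \<partial>lborel)"
    unfolding time_measure_def by (rule integral_restrict_space) simp
  also have "\<dots> = (\<integral>t. indicator {0..s} t *\<^sub>R deriv \<phi> t \<partial>lborel)"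
  proof (rule integral_cong_AE)
    have "(\<lambda>t. indicator {0<..<T} t *\<^sub>R (indicator {t<..} s * deriv \<phi> t))
        = (\<lambda>t. indicator {0<..<T} t *\<^sub>R (indicator {..<s} t * deriv \<phi> t))"
      by (auto simp: indicator_def)
    then show "(\<lambda>t. indicator {0<..<T} t *\<^sub>R (indicator {t<..} s * deriv \<phi> t)) \<in> borel_measurable lborel"
      by simp
    show "AE t in lborel. indicator {0<..<T} t *\<^sub>R (indicator {t<..} s * deriv \<phi> t)
        = indicator {0..s} t *\<^sub>R deriv \<phi> t"
      using AE_lborel_singleton[of 0] AE_lborel_singleton[of s]
      by eventually_elim (use assms in \<open>auto simp: indicator_def\<close>)
  qed simp
  also have "\<dots> = \<phi> s - \<phi> 0"
  proof (rule integral_FTC_atLeastAtMost)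
    show "(\<phi> has_vector_derivative deriv \<phi> x) (at x within {0..s})" for x
      using \<phi>(2)[of x] has_real_derivative_iff_has_vector_derivative has_vector_derivative_at_within
      by blast
  qed (use assms(1) continuous_on_subset[OF \<phi>(1)] in auto)
  finally show ?thesis .
qed

text \<open>Fubini replaces integration by parts: integrating \<open>deriv \<phi>\<close> first,
  over (0,s), leaves \<phi>(s), since \<phi>(0) = 0.\<close>

lemma weak_time_deriv_tail_integral:
  fixes k :: "real \<Rightarrow> 'a::{banach,second_countable_topology}"
  assumes k: "integrable (time_measure T) k"
  shows "weak_time_deriv T (tail_integral T k) (\<lambda>t. - k t)"
  unfolding weak_time_deriv_def
proof
  fix \<phi> assume "\<phi> \<in> test_functions T"
  note \<phi> = test_function_facts[OF this]
  let ?M = "time_measure T"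
  have [measurable]: "deriv \<phi> \<in> borel_measurable borel"
    using \<phi>(1) by (rule borel_measurable_continuous_onI)
  have [measurable]: "k \<in> borel_measurable ?M" using k by auto
  have [measurable]: "(\<lambda>t. t) \<in> borel_measurable ?M" by simp
  have bdd: "integrable ?M (deriv \<phi>)"
  proof -
    obtain B where B: "\<And>t. 0 < t \<Longrightarrow> t < T \<Longrightarrow> norm (deriv \<phi> t) \<le> B"
      using continuous_norm_bound_Ioo[OF \<phi>(1)] by metis
    show ?thesis
      by (rule time.integrable_const_bound[where B = B]) (use B in auto)
  qed
  define G where "G = (\<lambda>t s. indicator {t<..} s *\<^sub>R (deriv \<phi> t *\<^sub>R k s))"
  have "case_prod G = (\<lambda>p. (if fst p < snd p then 1 else 0) *\<^sub>R (deriv \<phi> (fst p) *\<^sub>R k (snd p)))"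
    by (auto simp: G_def)
  then have [measurable]: "case_prod G \<in> borel_measurable (?M \<Otimes>\<^sub>M ?M)"
    by simp
  have G: "integrable (?M \<Otimes>\<^sub>M ?M) (case_prod G)"
    by (rule integrable_time_product[OF bdd k]) (auto simp: G_def indicator_def)
  have "(\<integral>t. deriv \<phi> t *\<^sub>R tail_integral T k t \<partial>?M) = (\<integral>t. (\<integral>s. G t s \<partial>?M) \<partial>?M)"
  proof (rule Bochner_Integration.integral_cong[OF refl])
    fix t
    have "deriv \<phi> t *\<^sub>R tail_integral T k t = (\<integral>s. deriv \<phi> t *\<^sub>R (indicator {t<..} s *\<^sub>R k s) \<partial>?M)"
      unfolding tail_integral_def by (rule integral_scaleR_right[symmetric])
    then show "deriv \<phi> t *\<^sub>R tail_integral T k t = (\<integral>s. G t s \<partial>?M)"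
      unfolding G_def by (simp only: scaleR_left_commute)
  qed
  also have "\<dots> = (\<integral>s. (\<integral>t. G t s \<partial>?M) \<partial>?M)"
    by (rule time_pair.Fubini_integral[symmetric, OF G])
  also have "\<dots> = (\<integral>s. \<phi> s *\<^sub>R k s \<partial>?M)"
  proof (rule Bochner_Integration.integral_cong[OF refl])
    fix s assume "s \<in> space ?M"
    then have s: "0 < s" "s < T" by auto
    have int: "integrable ?M (\<lambda>t. indicator {t<..} s * deriv \<phi> t)"
    proof (rule Bochner_Integration.integrable_bound[OF bdd])
      have "(\<lambda>t. indicator {t<..} s * deriv \<phi> t) = (\<lambda>t. indicator {..<s} t * deriv \<phi> t)"
        by (auto simp: indicator_def)
      then show "(\<lambda>t. indicator {t<..} s * deriv \<phi> t) \<in> borel_measurable ?M" by simp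
    qed (auto simp: indicator_def)
    have "(\<integral>t. G t s \<partial>?M) = (\<integral>t. (indicator {t<..} s * deriv \<phi> t) *\<^sub>R k s \<partial>?M)"
      by (simp add: G_def)
    also have "\<dots> = (\<integral>t. indicator {t<..} s * deriv \<phi> t \<partial>?M) *\<^sub>R k s"
      by (rule integral_scaleR_left) (use int in auto)
    finally show "(\<integral>t. G t s \<partial>?M) = \<phi> s *\<^sub>R k s"
      using integral_deriv_time_measure[OF s \<phi>(1,2)] \<phi>(3) by simp
  qed
  finally show "(\<integral>t. deriv \<phi> t *\<^sub>R tail_integral T k t \<partial>?M) = - (\<integral>t. \<phi> t *\<^sub>R - k t \<partial>?M)"
    by simp
qed

section \<open>Backward ordinary differential equations\<close>

text \<open>Extending the integral to the half-line from \<open>t\<close> makes the bound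
  independent of \<open>T\<close>. It is the source of the contraction constant for the weighted
  fixed point problem.\<close>

lemma nn_integral_exp_decay:
  assumes "0 < \<kappa>"
  shows "(\<integral>\<^sup>+s. ennreal (indicator {t<..} s * exp (- \<kappa> * (s - t))) \<partial>time_measure T) \<le> ennreal (1 / \<kappa>)"
proof -
  have "(\<integral>\<^sup>+s. ennreal (indicator {t<..} s * exp (- \<kappa> * (s - t))) \<partial>time_measure T)
     = (\<integral>\<^sup>+s. ennreal (indicator {t<..} s * exp (- \<kappa> * (s - t))) * indicator {0<..<T} s \<partial>lborel)"
    unfolding time_measure_def by (rule nn_integral_restrict_space) simp
  also have "\<dots> \<le> (\<integral>\<^sup>+s. ennreal (exp (- \<kappa> * (s - t))) * indicator {t..} s \<partial>lborel)"
    by (rule nn_integral_mono) (auto simp: indicator_def)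
  also have "\<dots> = 0 - (- exp (- \<kappa> * (t - t)) / \<kappa>)"
  proof (rule nn_integral_FTC_atLeast[where F = "\<lambda>s. - exp (- \<kappa> * (s - t)) / \<kappa>"])
    show "((\<lambda>s. - exp (- \<kappa> * (s - t)) / \<kappa>) \<longlongrightarrow> 0) at_top"
      using assms by real_asymp
    show "((\<lambda>s. - exp (- \<kappa> * (s - t)) / \<kappa>) has_real_derivative exp (- \<kappa> * (x - t))) (at x)" for x
      using assms by (auto intro!: derivative_eq_intros)
  qed auto
  finally show ?thesis by simp
qed

lemma integrable_exp_decay:
  assumes "0 < \<kappa>"
  shows "integrable (time_measure T) (\<lambda>s. indicator {t<..} s * exp (- \<kappa> * (s - t)))"
    and "(\<integral>s. indicator {t<..} s * exp (- \<kappa> * (s - t)) \<partial>time_measure T) \<le> 1 / \<kappa>"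
proof -
  note le = nn_integral_exp_decay[OF assms, of T t]
  show int: "integrable (time_measure T) (\<lambda>s. indicator {t<..} s * exp (- \<kappa> * (s - t)))"
    by (rule integrableI_nonneg) (use le in \<open>auto simp: less_top[symmetric] top_unique\<close>)
  have "ennreal (\<integral>s. indicator {t<..} s * exp (- \<kappa> * (s - t)) \<partial>time_measure T) \<le> ennreal (1 / \<kappa>)"
    using le by (subst nn_integral_eq_integral[symmetric, OF int]) auto
  then show "(\<integral>s. indicator {t<..} s * exp (- \<kappa> * (s - t)) \<partial>time_measure T) \<le> 1 / \<kappa>"
    using assms by (simp add: ennreal_le_iff)
qed

text \<open>The solution is a fixed point in the weighted variable \<open>exp (\<kappa> (t - T)) x(t)\<close>, for which the
  integral operator is a contraction on the whole interval, whatever its length.\<close>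

lemma backward_ode_exists:
  fixes F :: "real \<Rightarrow> 'a::{banach,second_countable_topology} \<Rightarrow> 'a"
  assumes meas: "\<And>x. continuous_on UNIV x \<Longrightarrow> (\<lambda>s. F s (x s)) \<in> borel_measurable (time_measure T)"
    and lip: "\<And>s v w. 0 < s \<Longrightarrow> s < T \<Longrightarrow> norm (F s v - F s w) \<le> L * norm (v - w)"
    and int0: "integrable (time_measure T) (\<lambda>s. F s 0)"
    and L: "0 < L"
  obtains x where "continuous_on UNIV x" "integrable (time_measure T) (\<lambda>s. F s (x s))"
    "\<And>t. x t = tail_integral T (\<lambda>s. F s (x s)) t"
proof -
  let ?M = "time_measure T"
  \<comment> \<open>The factor 2 makes the contraction constant \<open>L / \<kappa>\<close> equal to
    1/2.\<close>
  define \<kappa> where "\<kappa> = 2 * L"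
  have \<kappa>: "0 < \<kappa>" using L by (simp add: \<kappa>_def)
  \<comment> \<open>The unknown \<xi> is the weighted variable, a bounded continuous function on the
    line; \<open>X\<close> removes the weight, and \<open>Y\<close> is the weighted image under the
    integral operator.\<close>
  define X where "X \<xi> t = exp (\<kappa> * (T - t)) *\<^sub>R apply_bcontfun \<xi> t" for \<xi> :: "real \<Rightarrow>\<^sub>C 'a" and t
  define Y where "Y \<xi> t = exp (- \<kappa> * (T - t)) *\<^sub>R tail_integral T (\<lambda>s. F s (X \<xi> s)) t" for \<xi> t
  have X_cont: "continuous_on UNIV (X \<xi>)" for \<xi>
    unfolding X_def by (intro continuous_intros continuous_on_apply_bcontfun)
  have m[measurable]: "(\<lambda>s. F s (X \<xi> s)) \<in> borel_measurable ?M" for \<xi>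
    by (rule meas[OF X_cont])
  have Xb: "norm (X \<xi> s) \<le> exp (\<kappa> * (T - s)) * norm \<xi>" for \<xi> s
    unfolding X_def using norm_bounded[of \<xi> s] by simp
  have Fb: "norm (F s (X \<xi> s)) \<le> norm (F s 0) + L * norm (X \<xi> s)" if "0 < s" "s < T" for s \<xi>
    using lip[OF that, of "X \<xi> s" 0] norm_triangle_sub[of "F s (X \<xi> s)" "F s 0"] by simp
  have int: "integrable ?M (\<lambda>s. F s (X \<xi> s))" for \<xi>
  proof (rule Bochner_Integration.integrable_bound)
    show "integrable ?M (\<lambda>s. norm (F s 0) + L * (exp (\<kappa> * T) * norm \<xi>))"
      using int0 by simp
    show "AE s in ?M. norm (F s (X \<xi> s)) \<le> norm (norm (F s 0) + L * (exp (\<kappa> * T) * norm \<xi>))"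
      using AE_time_measure
    proof eventually_elim
      case (elim s)
      have "norm (X \<xi> s) \<le> exp (\<kappa> * T) * norm \<xi>"
        using Xb[of \<xi> s] elim \<kappa> by (elim order_trans) (auto intro!: mult_right_mono)
      then have "L * norm (X \<xi> s) \<le> L * (exp (\<kappa> * T) * norm \<xi>)"
        using L by simp
      then show ?case using Fb[of s \<xi>] elim by auto
    qed
  qed simp
  have Yb: "Y \<xi> \<in> bcontfun" for \<xi>
  proof (rule bcontfun_normI)
    show "continuous_on UNIV (Y \<xi>)"
      unfolding Y_def by (intro continuous_intros continuous_on_tail_integral int)
    \<comment> \<open>This bound is uniform in \<open>t\<close>: where the indicator is nonzero, t <
      s < T, and both exponential factors below are at most 1. For t beyond \<open>T\<close>, where
      the weight grows, the tail integral vanishes.\<close>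
    define B where "B = (\<integral>s. norm (F s 0) + L * norm \<xi> \<partial>?M)"
    show "norm (Y \<xi> t) \<le> B" for t
    proof -
      have "Y \<xi> t = (\<integral>s. exp (- \<kappa> * (T - t)) *\<^sub>R (indicator {t<..} s *\<^sub>R F s (X \<xi> s)) \<partial>?M)"
        unfolding Y_def tail_integral_def by (rule integral_scaleR_right[symmetric])
      also have "norm \<dots> \<le> B"
        unfolding B_def
      proof (rule Bochner_Integration.integral_norm_bound_integral)
        show "integrable ?M (\<lambda>s. exp (- \<kappa> * (T - t)) *\<^sub>R (indicator {t<..} s *\<^sub>R F s (X \<xi> s)))"
          by (intro integrable_scaleR_right integrable_indicator_time int)
        show "integrable ?M (\<lambda>s. norm (F s 0) + L * norm \<xi>)"
          using int0 by simp
        fix s assume "s \<in> space ?M"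
        then have s: "0 < s" "s < T" by auto
        show "norm (exp (- \<kappa> * (T - t)) *\<^sub>R (indicator {t<..} s *\<^sub>R F s (X \<xi> s))) \<le> norm (F s 0) + L * norm \<xi>"
        proof (cases "t < s")
          case True
          have e1: "exp (- \<kappa> * (T - t)) \<le> 1"
            using True s \<kappa> by simp
          have e2: "exp (- \<kappa> * (T - t)) * exp (\<kappa> * (T - s)) \<le> 1"
            using True \<kappa> by (simp add: mult_exp_exp algebra_simps)
          have "norm (exp (- \<kappa> * (T - t)) *\<^sub>R (indicator {t<..} s *\<^sub>R F s (X \<xi> s)))
              = exp (- \<kappa> * (T - t)) * norm (F s (X \<xi> s))"
            using True by simp
          also have "\<dots> \<le> exp (- \<kappa> * (T - t)) * (norm (F s 0) + L * (exp (\<kappa> * (T - s)) * norm \<xi>))"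
            by (intro mult_left_mono order_trans[OF Fb[OF s]] add_mono order_refl Xb)
              (use L in auto)
          also have "\<dots> = exp (- \<kappa> * (T - t)) * norm (F s 0)
              + (exp (- \<kappa> * (T - t)) * exp (\<kappa> * (T - s))) * (L * norm \<xi>)"
            by (simp add: algebra_simps)
          also have "\<dots> \<le> 1 * norm (F s 0) + 1 * (L * norm \<xi>)"
            by (intro add_mono mult_right_mono e1 e2) (use L in auto)
          finally show ?thesis by simp
        qed (use L in auto)
      qed
      finally show ?thesis .
    qed
  qed
  define \<Psi> where "\<Psi> \<xi> = Bcontfun (Y \<xi>)" for \<xi>
  have \<Psi>: "apply_bcontfun (\<Psi> \<xi>) = Y \<xi>" for \<xi>
    unfolding \<Psi>_def by (rule Bcontfun_inverse[OF Yb])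
  have "dist (\<Psi> \<xi>) (\<Psi> \<eta>) \<le> 1/2 * dist \<xi> \<eta>" for \<xi> \<eta>
  proof (rule dist_bound)
    fix t
    let ?D = "\<lambda>s. F s (X \<xi> s) - F s (X \<eta> s)"
    have "Y \<xi> t - Y \<eta> t = exp (- \<kappa> * (T - t)) *\<^sub>R (tail_integral T (\<lambda>s. F s (X \<xi> s)) t - tail_integral T (\<lambda>s. F s (X \<eta> s)) t)"
      unfolding Y_def by (simp add: scaleR_diff_right)
    also have "tail_integral T (\<lambda>s. F s (X \<xi> s)) t - tail_integral T (\<lambda>s. F s (X \<eta> s)) t
        = (\<integral>s. indicator {t<..} s *\<^sub>R ?D s \<partial>?M)"
      unfolding tail_integral_def
      by (subst Bochner_Integration.integral_diff[symmetric])
        (auto intro!: integrable_indicator_time int simp: scaleR_diff_right)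
    also have "exp (- \<kappa> * (T - t)) *\<^sub>R \<dots> = (\<integral>s. exp (- \<kappa> * (T - t)) *\<^sub>R (indicator {t<..} s *\<^sub>R ?D s) \<partial>?M)"
      by (rule integral_scaleR_right[symmetric])
    finally have eq: "Y \<xi> t - Y \<eta> t = \<dots>" .
    have "norm (Y \<xi> t - Y \<eta> t) \<le> (\<integral>s. L * dist \<xi> \<eta> * (indicator {t<..} s * exp (- \<kappa> * (s - t))) \<partial>?M)"
      unfolding eq
    proof (rule Bochner_Integration.integral_norm_bound_integral)
      show "integrable ?M (\<lambda>s. exp (- \<kappa> * (T - t)) *\<^sub>R (indicator {t<..} s *\<^sub>R ?D s))"
        by (intro integrable_scaleR_right integrable_indicator_time Bochner_Integration.integrable_diff int)
      show "integrable ?M (\<lambda>s. L * dist \<xi> \<eta> * (indicator {t<..} s * exp (- \<kappa> * (s - t))))"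
        by (intro integrable_mult_right integrable_exp_decay \<kappa>)
      fix s assume "s \<in> space ?M"
      then have s: "0 < s" "s < T" by auto
      show "norm (exp (- \<kappa> * (T - t)) *\<^sub>R (indicator {t<..} s *\<^sub>R ?D s))
          \<le> L * dist \<xi> \<eta> * (indicator {t<..} s * exp (- \<kappa> * (s - t)))"
      proof (cases "t < s")
        case True
        have "norm (?D s) \<le> L * norm (X \<xi> s - X \<eta> s)" by (rule lip[OF s])
        also have "norm (X \<xi> s - X \<eta> s) = exp (\<kappa> * (T - s)) * dist (\<xi> s) (\<eta> s)"
          unfolding X_def by (simp add: scaleR_diff_right[symmetric] dist_norm)
        also have "\<dots> \<le> exp (\<kappa> * (T - s)) * dist \<xi> \<eta>"
          by (intro mult_left_mono dist_bounded) auto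
        finally have "norm (?D s) \<le> L * (exp (\<kappa> * (T - s)) * dist \<xi> \<eta>)"
          using L by simp
        then have "exp (- \<kappa> * (T - t)) * norm (?D s)
            \<le> exp (- \<kappa> * (T - t)) * (L * (exp (\<kappa> * (T - s)) * dist \<xi> \<eta>))"
          by (rule mult_left_mono) simp
        also have "\<dots> = L * dist \<xi> \<eta> * (exp (- \<kappa> * (T - t)) * exp (\<kappa> * (T - s)))"
          by simp
        \<comment> \<open>The two weights combine to a decay in s - t, whose integral is at most
          1/\<kappa>.\<close>
        also have "exp (- \<kappa> * (T - t)) * exp (\<kappa> * (T - s)) = exp (- \<kappa> * (s - t))"
          by (simp add: mult_exp_exp algebra_simps)
        finally show ?thesis using True by simp
      qed simp
    qed
    also have "\<dots> = L * dist \<xi> \<eta> * (\<integral>s. indicator {t<..} s * exp (- \<kappa> * (s - t)) \<partial>?M)"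
      by simp
    also have "\<dots> \<le> L * dist \<xi> \<eta> * (1 / \<kappa>)"
      by (intro mult_left_mono integrable_exp_decay \<kappa>) (use L in auto)
    also have "\<dots> = 1/2 * dist \<xi> \<eta>"
      using L by (simp add: \<kappa>_def)
    finally show "dist (\<Psi> \<xi> t) (\<Psi> \<eta> t) \<le> 1/2 * dist \<xi> \<eta>"
      by (simp add: \<Psi> dist_norm)
  qed
  then obtain \<xi> where \<xi>: "\<Psi> \<xi> = \<xi>"
    using banach_fix_type[of "1/2" \<Psi>] by auto
  show ?thesis
  proof (rule that[of "X \<xi>"])
    show "X \<xi> t = tail_integral T (\<lambda>s. F s (X \<xi> s)) t" for t
    proof -
      have "apply_bcontfun \<xi> t = Y \<xi> t" using \<Psi>[of \<xi>] \<xi> by simp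
      then have "X \<xi> t = exp (\<kappa> * (T - t)) *\<^sub>R Y \<xi> t"
        unfolding X_def by simp
      also have "\<dots> = tail_integral T (\<lambda>s. F s (X \<xi> s)) t"
        unfolding Y_def by (simp add: exp_minus)
      finally show ?thesis .
    qed
  qed (rule X_cont int)+
qed

section \<open>Dual norms on finite-dimensional subspaces\<close>

text \<open>Fourier coefficients are linear in \<open>y\<close>, so induction over the span reduces
  the claim to members of \<open>C\<close>. A zero vector in \<open>C\<close> does no harm, as its
  coefficient is 0/0 = 0.\<close>

lemma orthogonal_expansion:
  fixes C :: "'a::real_inner set"
  assumes "finite C" "pairwise orthogonal C" "y \<in> span C"
  shows "y = (\<Sum>c\<in>C. ((y \<bullet> c) / (c \<bullet> c)) *\<^sub>R c)"
  using assms(3)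
proof (induction rule: span_induct_alt)
  case base
  then show ?case by simp
next
  case (step r x y)
  have "(\<Sum>c\<in>C. ((x \<bullet> c) / (c \<bullet> c)) *\<^sub>R c) = (\<Sum>c\<in>C. if c = x then x else 0)"
    using assms(2) step(1) by (intro sum.cong) (auto simp: pairwise_def orthogonal_def)
  then have x: "(\<Sum>c\<in>C. ((x \<bullet> c) / (c \<bullet> c)) *\<^sub>R c) = x"
    using step(1) assms(1) by simp
  have "(\<Sum>c\<in>C. (((r *\<^sub>R x + y) \<bullet> c) / (c \<bullet> c)) *\<^sub>R c)
      = r *\<^sub>R (\<Sum>c\<in>C. ((x \<bullet> c) / (c \<bullet> c)) *\<^sub>R c) + (\<Sum>c\<in>C. ((y \<bullet> c) / (c \<bullet> c)) *\<^sub>R c)"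
    by (simp add: inner_add_left add_divide_distrib scaleR_add_left sum.distrib scaleR_sum_right)
  also have "\<dots> = r *\<^sub>R x + y"
    using x step(2) by simp
  finally show ?case by simp
qed

text \<open>Orthogonalise the image of \<open>B\<close> in H, normalise, and pull back along
  \<iota>. In the resulting system the H-inner products are the coordinates, so testing an equation
  in \<open>span B\<close> determines its solution explicitly.\<close>

lemma orthonormal_pullback:
  fixes \<iota> :: "'v::real_normed_vector \<Rightarrow> 'h::real_inner"
  assumes lin: "linear \<iota>" and inj: "inj \<iota>" and fin: "finite B"
  obtains I :: "'h set" and b :: "'h \<Rightarrow> 'v"
  where "finite I" "\<And>i. i \<in> I \<Longrightarrow> b i \<in> span B"
    "\<And>w. w \<in> span B \<Longrightarrow> w = (\<Sum>i\<in>I. (\<iota> (b i) \<bullet> \<iota> w) *\<^sub>R b i)"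
proof -
  obtain I where I: "finite I" "span I = span (\<iota> ` B)" "pairwise orthogonal I"
    using basis_orthogonal[of "\<iota> ` B"] fin by auto
  have sp: "span I = \<iota> ` span B"
    using I(2) by (simp add: linear_span_image[OF lin])
  define b where "b c = (1 / norm c) *\<^sub>R inv \<iota> c" for c
  have inv: "inv \<iota> c \<in> span B" "\<iota> (inv \<iota> c) = c" if "c \<in> span I" for c
    using that inj unfolding sp by (auto simp: inv_f_f)
  have b: "\<iota> (b c) = (1 / norm c) *\<^sub>R c" if "c \<in> I" for c
    unfolding b_def using inv(2)[OF span_base[OF that]] by (simp add: linear_scale[OF lin])
  show ?thesis
  proof (rule that[of I b])
    show "b i \<in> span B" if "i \<in> I" for i
      unfolding b_def by (intro span_scale inv span_base that)
    fix w assume "w \<in> span B"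
    then have "\<iota> w \<in> span I" unfolding sp by blast
    from orthogonal_expansion[OF I(1,3) this]
    have "\<iota> w = (\<Sum>c\<in>I. ((\<iota> w \<bullet> c) / (c \<bullet> c)) *\<^sub>R c)" .
    also have "\<dots> = (\<Sum>c\<in>I. (\<iota> (b c) \<bullet> \<iota> w) *\<^sub>R \<iota> (b c))"
      by (intro sum.cong refl) (simp add: b inner_commute dot_square_norm power2_eq_square)
    also have "\<dots> = \<iota> (\<Sum>c\<in>I. (\<iota> (b c) \<bullet> \<iota> w) *\<^sub>R b c)"
      by (simp add: linear_sum[OF lin] linear_scale[OF lin])
    finally show "w = (\<Sum>i\<in>I. (\<iota> (b i) \<bullet> \<iota> w) *\<^sub>R b i)"
      using inj by (simp add: inj_eq)
  qed (rule I)
qed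

lemma bounded_linear_dual_embed:
  "bounded_linear (\<lambda>v. dual_embed \<iota> (blinfun_apply \<iota> v))"
proof (rule bounded_linear_intro[where K = "norm \<iota> * norm \<iota>"])
  fix v
  show "norm (dual_embed \<iota> (blinfun_apply \<iota> v)) \<le> norm v * (norm \<iota> * norm \<iota>)"
    unfolding dual_embed_def
  proof (rule norm_blinfun_bound)
    fix w
    have "\<bar>blinfun_apply \<iota> v \<bullet> blinfun_apply \<iota> w\<bar> \<le> norm (blinfun_apply \<iota> v) * norm (blinfun_apply \<iota> w)"
      by (rule Cauchy_Schwarz_ineq2)
    also have "\<dots> \<le> (norm \<iota> * norm v) * (norm \<iota> * norm w)"
      by (intro mult_mono norm_blinfun) auto
    finally show "norm (blinfun_apply (blinfun_inner_right (blinfun_apply \<iota> v) o\<^sub>L \<iota>) w)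
        \<le> norm v * (norm \<iota> * norm \<iota>) * norm w"
      by (simp add: mult_ac)
  qed simp
qed (auto intro!: blinfun_eqI simp: dual_embed_def blinfun.add_right blinfun.add_left
      blinfun.scaleR_left blinfun.scaleR_right inner_add_left)

lemma dual_embed_apply [simp]: "blinfun_apply (dual_embed \<iota> y) w = y \<bullet> blinfun_apply \<iota> w"
  by (simp add: dual_embed_def)

lemma bdd_above_dual_norm_on:
  "bdd_above ((\<lambda>w. blinfun_apply \<iota> v \<bullet> blinfun_apply \<iota> w) ` {w \<in> W. norm w = 1})"
proof (rule bdd_aboveI2)
  fix w assume "w \<in> {w \<in> W. norm w = 1}"
  then have "norm (blinfun_apply \<iota> w) \<le> norm \<iota>" using norm_blinfun[of \<iota> w] by simp
  then have "norm (blinfun_apply \<iota> v) * norm (blinfun_apply \<iota> w) \<le> norm (blinfun_apply \<iota> v) * norm \<iota>"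
    by (intro mult_left_mono) auto
  then show "blinfun_apply \<iota> v \<bullet> blinfun_apply \<iota> w \<le> norm (blinfun_apply \<iota> v) * norm \<iota>"
    using norm_cauchy_schwarz[of "blinfun_apply \<iota> v" "blinfun_apply \<iota> w"] by linarith
qed

text \<open>Rescaling to norm one reduces this to the supremum; applying it to both \<open>w\<close>
  and \<open>- w\<close> yields the absolute value.\<close>

lemma dual_norm_on_upper:
  assumes "w \<in> W" "subspace W"
  shows "\<bar>blinfun_apply \<iota> v \<bullet> blinfun_apply \<iota> w\<bar> \<le> dual_norm_on \<iota> W v * norm w"
proof (cases "w = 0")
  case False
  have "blinfun_apply \<iota> v \<bullet> blinfun_apply \<iota> w' \<le> dual_norm_on \<iota> W v * norm w" 
    if "w' \<in> W" "norm w' = norm w" for w'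
  proof -
    have "blinfun_apply \<iota> v \<bullet> blinfun_apply \<iota> (w' /\<^sub>R norm w) \<le> dual_norm_on \<iota> W v"
      unfolding dual_norm_on_def
      by (rule cSUP_upper[OF _ bdd_above_dual_norm_on])
        (use that assms False in \<open>auto intro: subspace_scale\<close>)
    then show ?thesis
      using False by (simp add: blinfun.scaleR_right field_simps)
  qed
  from this[of w] this[of "- w"] show ?thesis
    using assms by (auto simp: blinfun.minus_right subspace_neg)
qed simp

text \<open>A nonzero vector of \<open>W\<close> keeps the supremum from running over the empty set,
  where its real value would be unspecified.\<close>

lemma dual_norm_on_nonneg:
  assumes "subspace W" "W \<noteq> {0}"
  shows "0 \<le> dual_norm_on \<iota> W v"
proof -
  obtain w where w: "w \<in> W" "w \<noteq> 0"
    using assms subspace_0 by blast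
  then have "0 \<le> dual_norm_on \<iota> W v * norm w"
    using dual_norm_on_upper[OF w(1) assms(1), of \<iota> v] by linarith
  then show ?thesis using w(2) by (simp add: zero_le_mult_iff)
qed

lemma norm_dual_embed_le:
  assumes "v \<noteq> 0"
  shows "norm (dual_embed \<iota> (blinfun_apply \<iota> v)) \<le> dual_norm_on \<iota> UNIV v"
proof (rule norm_blinfun_bound)
  show "norm (blinfun_apply (dual_embed \<iota> (blinfun_apply \<iota> v)) w) \<le> dual_norm_on \<iota> UNIV v * norm w" for w
    using dual_norm_on_upper[of w UNIV \<iota> v] by simp
  show "0 \<le> dual_norm_on \<iota> UNIV v"
    using assms by (intro dual_norm_on_nonneg) auto
qed

text \<open>Testing with \<open>v\<close> itself gives the square of its H-norm, which injectivity
  of \<iota> makes positive. Hence the quotients in \<open>dual_norm_ratio\<close> have nonzero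
  denominators.\<close>

lemma dual_norm_on_pos:
  assumes "v \<in> W" "v \<noteq> 0" "subspace W" "inj (blinfun_apply \<iota>)"
  shows "0 < dual_norm_on \<iota> W v"
proof -
  have "blinfun_apply \<iota> v \<noteq> 0"
    using assms(2,4) by (metis blinfun.zero_right injD)
  then have "0 < dual_norm_on \<iota> W v * norm v"
    using dual_norm_on_upper[OF assms(1,3), of \<iota> v] by (smt (verit) inner_gt_zero_iff)
  then show ?thesis
    using assms(2) by (simp add: zero_less_mult_iff)
qed

lemma dual_norm_ratio_bound:
  assumes "dual_norm_ratio \<iota> W = ennreal C" "0 \<le> C" "subspace W" "inj (blinfun_apply \<iota>)" "v \<in> W" "W \<noteq> {0}"
  shows "norm (dual_embed \<iota> (blinfun_apply \<iota> v)) \<le> C * dual_norm_on \<iota> W v"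
proof (cases "v = 0")
  case True
  then show ?thesis
    using linear_simps(3)[OF bounded_linear_dual_embed, of \<iota>] assms(2)
      dual_norm_on_nonneg[OF assms(3,6), of \<iota> 0]
    by simp
next
  case False
  have "ennreal (dual_norm_on \<iota> UNIV v / dual_norm_on \<iota> W v) \<le> dual_norm_ratio \<iota> W"
    unfolding dual_norm_ratio_def by (rule SUP_upper) (use assms False in auto)
  then have "dual_norm_on \<iota> UNIV v / dual_norm_on \<iota> W v \<le> C"
    using assms(1,2) by (simp add: ennreal_le_iff)
  then have "dual_norm_on \<iota> UNIV v \<le> C * dual_norm_on \<iota> W v"
    using dual_norm_on_pos[OF assms(5) False assms(3,4)] by (simp add: field_simps)
  with norm_dual_embed_le[OF False, of \<iota>] show ?thesis by simp
qed

text \<open>Passing from \<open>W\<close> to the whole space enlarges the set of unit test vectors.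
  The bound lets \<open>C\<close> be inserted as a factor when \<kappa> is estimated.\<close>

lemma dual_norm_ratio_ge_1:
  assumes "subspace W" "W \<noteq> {0}" "inj (blinfun_apply \<iota>)"
  shows "1 \<le> dual_norm_ratio \<iota> W"
proof -
  obtain v where v: "v \<in> W" "v \<noteq> 0"
    using assms(1,2) subspace_0 by blast
  note pos = dual_norm_on_pos[OF v assms(1,3)]
  have "(1 / norm v) *\<^sub>R v \<in> {w \<in> W. norm w = 1}"
    using v assms(1) by (auto intro: subspace_scale)
  then have "dual_norm_on \<iota> W v \<le> dual_norm_on \<iota> UNIV v"
    unfolding dual_norm_on_def by (intro cSUP_subset_mono bdd_above_dual_norm_on) auto
  then have "1 \<le> dual_norm_on \<iota> UNIV v / dual_norm_on \<iota> W v"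
    using pos by simp
  then have "1 \<le> ennreal (dual_norm_on \<iota> UNIV v / dual_norm_on \<iota> W v)"
    using ennreal_leI by fastforce
  also have "\<dots> \<le> dual_norm_ratio \<iota> W"
    unfolding dual_norm_ratio_def by (rule SUP_upper) (use v in auto)
  finally show ?thesis .
qed

section \<open>Stability of the discrete adjoint problem\<close>

lemma integrable_L2_space:
  assumes "y \<in> L2_space T norm W"
  shows "y \<in> borel_measurable (time_measure T)" "integrable (time_measure T) (\<lambda>t. (norm (y t))\<^sup>2)"
proof -
  show [measurable]: "y \<in> borel_measurable (time_measure T)"
    using assms by (simp add: L2_space_def)
  show "integrable (time_measure T) (\<lambda>t. (norm (y t))\<^sup>2)"
    by (rule integrableI_nonneg) (use assms in \<open>auto simp: L2_space_def\<close>)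
qed

lemma L2_spaceI:
  assumes "y \<in> borel_measurable (time_measure T)" "AE t in time_measure T. y t \<in> W"
    "integrable (time_measure T) B" "AE t in time_measure T. (N (y t))\<^sup>2 \<le> B t"
  shows "y \<in> L2_space T N W"
proof -
  have "(\<integral>\<^sup>+t. ennreal ((N (y t))\<^sup>2) \<partial>time_measure T) \<le> (\<integral>\<^sup>+t. ennreal (norm (B t)) \<partial>time_measure T)"
    using assms(4) by (intro nn_integral_mono_AE) (auto elim!: eventually_mono intro!: ennreal_leI)
  also have "\<dots> < \<top>"
    using assms(3) by (simp add: integrable_iff_bounded)
  finally show ?thesis using assms(1,2) by (simp add: L2_space_def)
qed

lemma L2_space_diff_scale:
  fixes y z :: "real \<Rightarrow> 'a::{real_normed_vector,second_countable_topology}"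
  assumes "y \<in> L2_space T norm W" "z \<in> L2_space T norm W'"
  shows "(\<lambda>t. y t - s *\<^sub>R z t) \<in> L2_space T norm UNIV"
proof (rule L2_spaceI)
  note y = integrable_L2_space[OF assms(1)] and z = integrable_L2_space[OF assms(2)]
  note [measurable] = y(1) z(1)
  show "(\<lambda>t. y t - s *\<^sub>R z t) \<in> borel_measurable (time_measure T)" by measurable
  show "integrable (time_measure T) (\<lambda>t. 2 * (norm (y t))\<^sup>2 + 2 * s\<^sup>2 * (norm (z t))\<^sup>2)"
    using y z by simp
  show "AE t in time_measure T. (norm (y t - s *\<^sub>R z t))\<^sup>2 \<le> 2 * (norm (y t))\<^sup>2 + 2 * s\<^sup>2 * (norm (z t))\<^sup>2"
  proof (rule AE_I2)
    fix t
    have "(norm (y t - s *\<^sub>R z t))\<^sup>2 \<le> (norm (y t) + norm (s *\<^sub>R z t))\<^sup>2"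
      by (intro power_mono norm_triangle_ineq4) simp
    also have "\<dots> \<le> 2 * (norm (y t))\<^sup>2 + 2 * (norm (s *\<^sub>R z t))\<^sup>2"
      using sum_squares_bound[of "norm (y t)" "norm (s *\<^sub>R z t)"] by (simp add: power2_sum)
    finally show "(norm (y t - s *\<^sub>R z t))\<^sup>2 \<le> 2 * (norm (y t))\<^sup>2 + 2 * s\<^sup>2 * (norm (z t))\<^sup>2"
      by (simp add: power_mult_distrib)
  qed
qed simp

lemma L2_space_integrable:
  fixes y :: "real \<Rightarrow> 'a::{banach,second_countable_topology}"
  assumes "y \<in> L2_space T norm W"
  shows "integrable (time_measure T) y"
proof (rule Bochner_Integration.integrable_bound)
  note y = integrable_L2_space[OF assms]
  show "integrable (time_measure T) (\<lambda>t. 1 + (norm (y t))\<^sup>2)" using y by simp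
  have "norm (y t) \<le> 1 + (norm (y t))\<^sup>2" for t
    using sum_squares_bound[of 1 "norm (y t)"] by (simp add: power2_eq_square) (smt (verit) norm_ge_zero)
  then show "AE t in time_measure T. norm (y t) \<le> norm (1 + (norm (y t))\<^sup>2)" by simp
qed (use integrable_L2_space[OF assms] in simp)

text \<open>The situation for one fixed sample: \<mu> and \<nu> stand for the values of
  \<open>A_min\<close> and \<open>A_max\<close>, and \<open>C\<close> is the real value of the ratio
  of dual norms on \<open>W\<close>, spanned by the finite set \<open>B\<close>.\<close>

locale symmetric_form =
  fixes T :: real and \<iota> :: "'v::{real_inner,banach,second_countable_topology}
      \<Rightarrow>\<^sub>L 'h::{real_inner,banach,second_countable_topology}"
    and a :: "real \<Rightarrow> 'v \<Rightarrow>\<^sub>L ('v \<Rightarrow>\<^sub>L real)" and \<mu> \<nu> :: real and W :: "'v set" and B :: "'v set" and C :: real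
  assumes inj: "inj (blinfun_apply \<iota>)"
    and \<mu>: "0 < \<mu>" and \<nu>: "0 < \<nu>"
    and a_meas: "\<And>v. (\<lambda>t. blinfun_apply (a t) v) \<in> borel_measurable (time_measure T)"
    and a_bounded: "\<And>t v w. 0 < t \<Longrightarrow> t < T \<Longrightarrow>
      \<bar>blinfun_apply (blinfun_apply (a t) v) w\<bar> \<le> \<nu> * norm v * norm w"
    and a_coercive: "\<And>t v. 0 < t \<Longrightarrow> t < T \<Longrightarrow> \<mu> * (norm v)\<^sup>2 \<le> blinfun_apply (blinfun_apply (a t) v) v"
    and a_sym: "\<And>t v w. 0 < t \<Longrightarrow> t < T \<Longrightarrow>
      blinfun_apply (blinfun_apply (a t) v) w = blinfun_apply (blinfun_apply (a t) w) v"
    and W: "finite B" "W = span B" "W \<noteq> {0}"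
    and C: "dual_norm_ratio \<iota> W = ennreal C" "1 \<le> C"
begin

abbreviation form where "form t v w \<equiv> blinfun_apply (blinfun_apply (a t) v) w"

text \<open>The integrand of the adjoint form when x' = -h, evaluated at \<open>v\<close> in the
  first argument.\<close>

abbreviation pair where
  "pair h x t v \<equiv> blinfun_apply \<iota> h \<bullet> blinfun_apply \<iota> v + form t v x"

section \<open>Pointwise estimates for the discrete adjoint equation\<close>

lemma subspace_W: "subspace W"
  by (simp add: W)

text \<open>Testing with \<open>x + s w\<close>, where \<open>s = \<langle>h, w\<rangle> / \<nu>\<close>, replaces the use of the inverse of the
  discrete operator in the maximal regularity estimate.\<close>

lemma maximal_regularity_pointwise:
  assumes t: "0 < t" "t < T" and x: "x \<in> W" and w: "w \<in> W" "norm w = 1"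
    and eq: "\<And>v. v \<in> W \<Longrightarrow> pair h x t v = z \<bullet> v"
  shows "(blinfun_apply \<iota> h \<bullet> blinfun_apply \<iota> w)\<^sup>2 / \<nu> + \<mu> * (norm x)\<^sup>2
      + 2 * (blinfun_apply \<iota> h \<bullet> blinfun_apply \<iota> x) \<le> (norm z)\<^sup>2 / \<mu>"
proof -
  define d where "d = blinfun_apply \<iota> h \<bullet> blinfun_apply \<iota> w"
  define s where "s = d / \<nu>"
  define y where "y = x + s *\<^sub>R w"
  have y: "y \<in> W"
    unfolding y_def by (intro subspace_add subspace_scale subspace_W x w)
  have ww: "form t w w \<le> \<nu>"
    using a_bounded[OF t, of w w] w by simp
  \<comment> \<open>By symmetry, half of this expression contains the cross term
    \<open>s * form t x w\<close> exactly as \<open>pair h x t y\<close> does, so the two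
    cancel.\<close>
  have yy: "form t y y = form t x x + 2 * s * form t x w + s\<^sup>2 * form t w w"
    unfolding y_def using a_sym[OF t, of w x]
    by (simp add: blinfun.add_left blinfun.add_right blinfun.scaleR_left blinfun.scaleR_right
        power2_eq_square algebra_simps)
  have "blinfun_apply \<iota> h \<bullet> blinfun_apply \<iota> x + s * d + form t x x + s * form t x w = pair h x t y"
    unfolding y_def d_def using a_sym[OF t, of w x]
    by (simp add: blinfun.add_left blinfun.add_right blinfun.scaleR_left blinfun.scaleR_right
        inner_add_right algebra_simps)
  also have "\<dots> = z \<bullet> y" by (rule eq[OF y])
  also have "\<dots> \<le> norm z * norm y" by (rule norm_cauchy_schwarz)
  \<comment> \<open>Young's inequality with weight \<mu>, so that coercivity turns the last term
    into half of \<open>form t y y\<close>.\<close>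
  also have "\<dots> \<le> (norm z)\<^sup>2 / (2 * \<mu>) + \<mu> * (norm y)\<^sup>2 / 2"
  proof -
    have "0 \<le> (norm z - \<mu> * norm y)\<^sup>2" by simp
    then show ?thesis using \<mu> by (simp add: power2_eq_square field_simps)
  qed
  also have "\<dots> \<le> (norm z)\<^sup>2 / (2 * \<mu>) + form t y y / 2"
    using a_coercive[OF t, of y] by simp
  also have "\<dots> \<le> (norm z)\<^sup>2 / (2 * \<mu>) + (form t x x + 2 * s * form t x w + s\<^sup>2 * \<nu>) / 2"
    unfolding yy using mult_left_mono[OF ww, of "s\<^sup>2"] by (simp add: divide_right_mono)
  finally have "2 * (blinfun_apply \<iota> h \<bullet> blinfun_apply \<iota> x) + 2 * s * d + form t x x \<le> (norm z)\<^sup>2 / \<mu> + s\<^sup>2 * \<nu>"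
    by (simp add: field_simps)
  \<comment> \<open>The choice of \<open>s\<close> maximises 2 s d - s^2 \<nu>; the maximum is d^2 /
    \<nu>.\<close>
  moreover have "s * d = d\<^sup>2 / \<nu>" "s\<^sup>2 * \<nu> = d\<^sup>2 / \<nu>"
    using \<nu> by (simp_all add: s_def power2_eq_square)
  ultimately show ?thesis
    using a_coercive[OF t, of x] unfolding d_def by (simp add: mult.assoc)
qed

text \<open>The previous bound holds for every unit vector \<open>w\<close> of \<open>W\<close>;
  taking the supremum over \<open>w\<close> gives the dual norm. One existing unit vector shows that
  the right side is nonnegative, so its square root can be used.\<close>

lemma dual_norm_pointwise:
  assumes t: "0 < t" "t < T" and x: "x \<in> W"
    and eq: "\<And>v. v \<in> W \<Longrightarrow> pair h x t v = z \<bullet> v"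
  shows "(dual_norm_on \<iota> W h)\<^sup>2
      \<le> \<nu> * ((norm z)\<^sup>2 / \<mu> - \<mu> * (norm x)\<^sup>2 - 2 * (blinfun_apply \<iota> h \<bullet> blinfun_apply \<iota> x))"
    (is "_ \<le> ?S")
proof -
  have sq: "(blinfun_apply \<iota> h \<bullet> blinfun_apply \<iota> w)\<^sup>2 \<le> ?S" if "w \<in> W" "norm w = 1" for w
    using maximal_regularity_pointwise[OF t x that eq] \<nu> by (simp add: field_simps)
  obtain v where v: "v \<in> W" "v \<noteq> 0"
    using W(3) subspace_0[OF subspace_W] by blast
  then have ex: "(1 / norm v) *\<^sub>R v \<in> {w \<in> W. norm w = 1}"
    by (auto intro: subspace_scale[OF subspace_W])
  then have S: "0 \<le> ?S"
    using sq[of "(1 / norm v) *\<^sub>R v"] by (auto intro: order_trans[OF zero_le_power2])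
  have "dual_norm_on \<iota> W h \<le> sqrt ?S"
    unfolding dual_norm_on_def
    by (rule cSUP_least) (use ex sq real_le_rsqrt in auto)
  then have "(dual_norm_on \<iota> W h)\<^sup>2 \<le> (sqrt ?S)\<^sup>2"
    by (intro power_mono dual_norm_on_nonneg subspace_W W)
  with S show ?thesis by simp
qed

text \<open>The Cauchy-Schwarz constant in (E + \<nu> r)^2 \<le> \<kappa> (E^2 / (C^2 \<nu>) + \<mu>
  r^2), with E the dual norm of the derivative and r the norm of x.\<close>

definition \<kappa> where "\<kappa> = C\<^sup>2 * \<nu> + \<nu>\<^sup>2 / \<mu>"

text \<open>In the expanded square, \<open>1 \<le> C\<close> dominates the second summand of
  \<kappa>, and the surplus terms are nonnegative.\<close>

lemma \<kappa>: "0 < \<kappa>" "\<kappa> \<le> \<mu> * (C * (1 + \<nu> / \<mu>))\<^sup>2"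
proof -
  show "0 < \<kappa>"
    unfolding \<kappa>_def using \<mu> \<nu> by (intro add_nonneg_pos) auto
  have C2: "1 \<le> C\<^sup>2" using C(2) by simp
  have "\<nu>\<^sup>2 / \<mu> \<le> C\<^sup>2 * (\<nu>\<^sup>2 / \<mu>)"
    using mult_right_mono[OF C2, of "\<nu>\<^sup>2 / \<mu>"] \<mu> by simp
  moreover have "0 \<le> C\<^sup>2 * \<mu>" "0 \<le> C\<^sup>2 * \<nu>" using \<mu> \<nu> by auto
  moreover have "\<mu> * (C * (1 + \<nu> / \<mu>))\<^sup>2 = C\<^sup>2 * \<mu> + 2 * (C\<^sup>2 * \<nu>) + C\<^sup>2 * (\<nu>\<^sup>2 / \<mu>)"
    using \<mu> by (simp add: power2_eq_square field_simps)
  ultimately show "\<kappa> \<le> \<mu> * (C * (1 + \<nu> / \<mu>))\<^sup>2"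
    unfolding \<kappa>_def by linarith
qed

text \<open>The vector \<open>v\<close> ranges over all of V, since the error does not lie in
  \<open>W\<close>; this is why the full dual norm of \<open>h\<close>, and with it
  \<open>C\<close>, enters. The energy of \<open>x\<close> gained by maximal regularity pays for the
  term \<open>form t v x\<close>.\<close>

lemma pair_norm_pointwise:
  assumes t: "0 < t" "t < T" and x: "x \<in> W" and h: "h \<in> W"
    and eq: "\<And>v. v \<in> W \<Longrightarrow> pair h x t v = z \<bullet> v"
  shows "(pair h x t v)\<^sup>2
      \<le> \<kappa> * ((norm z)\<^sup>2 / \<mu> - 2 * (blinfun_apply \<iota> h \<bullet> blinfun_apply \<iota> x)) * (norm v)\<^sup>2"
    and "(norm (dual_embed \<iota> (blinfun_apply \<iota> h)))\<^sup>2
      \<le> C\<^sup>2 * \<nu> * ((norm z)\<^sup>2 / \<mu> - 2 * (blinfun_apply \<iota> h \<bullet> blinfun_apply \<iota> x))"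
proof -
  define E where "E = norm (dual_embed \<iota> (blinfun_apply \<iota> h))"
  define S where "S = (norm z)\<^sup>2 / \<mu> - \<mu> * (norm x)\<^sup>2 - 2 * (blinfun_apply \<iota> h \<bullet> blinfun_apply \<iota> x)"
  have "E \<le> C * dual_norm_on \<iota> W h"
    unfolding E_def by (rule dual_norm_ratio_bound) (use C subspace_W inj h W in auto)
  then have "E\<^sup>2 \<le> (C * dual_norm_on \<iota> W h)\<^sup>2"
    by (rule power_mono) (simp add: E_def)
  also have "\<dots> \<le> C\<^sup>2 * (\<nu> * S)"
    unfolding power_mult_distrib S_def by (intro mult_left_mono dual_norm_pointwise[OF t x eq]) auto
  finally have E2: "E\<^sup>2 \<le> C\<^sup>2 * \<nu> * S" by simp
  have "C\<^sup>2 * \<nu> * S \<le> C\<^sup>2 * \<nu> * ((norm z)\<^sup>2 / \<mu> - 2 * (blinfun_apply \<iota> h \<bullet> blinfun_apply \<iota> x))"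
    using \<mu> \<nu> by (intro mult_left_mono) (auto simp: S_def)
  with E2 show "(norm (dual_embed \<iota> (blinfun_apply \<iota> h)))\<^sup>2
      \<le> C\<^sup>2 * \<nu> * ((norm z)\<^sup>2 / \<mu> - 2 * (blinfun_apply \<iota> h \<bullet> blinfun_apply \<iota> x))"
    unfolding E_def by simp
  have "\<bar>pair h x t v\<bar> \<le> \<bar>blinfun_apply \<iota> h \<bullet> blinfun_apply \<iota> v\<bar> + \<bar>form t v x\<bar>"
    by (rule abs_triangle_ineq)
  also have "\<dots> \<le> E * norm v + \<nu> * norm v * norm x"
    using norm_blinfun[of "dual_embed \<iota> (blinfun_apply \<iota> h)" v] a_bounded[OF t, of v x]
    by (simp add: E_def)
  finally have "\<bar>pair h x t v\<bar> \<le> (E + \<nu> * norm x) * norm v"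
    by (simp add: algebra_simps)
  then have "(pair h x t v)\<^sup>2 \<le> ((E + \<nu> * norm x) * norm v)\<^sup>2"
    by (metis abs_ge_zero power2_abs power_mono)
  also have "\<dots> = (E + \<nu> * norm x)\<^sup>2 * (norm v)\<^sup>2"
    by (rule power_mult_distrib)
  also have "\<dots> \<le> \<kappa> * (S + \<mu> * (norm x)\<^sup>2) * (norm v)\<^sup>2"
  proof (rule mult_right_mono)
    \<comment> \<open>The ratio of the two summands of \<kappa>. With this weight in Young's
      inequality both coefficients become multiples of \<kappa>.\<close>
    define \<delta> where "\<delta> = \<nu> / (C\<^sup>2 * \<mu>)"
    have \<delta>: "0 < \<delta>" using \<mu> \<nu> C by (simp add: \<delta>_def)
    have "0 \<le> (\<delta> * E - \<nu> * norm x)\<^sup>2" by simp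
    then have "2 * \<delta> * E * (\<nu> * norm x) \<le> \<delta>\<^sup>2 * E\<^sup>2 + (\<nu> * norm x)\<^sup>2"
      by (simp add: power2_eq_square algebra_simps)
    then have "\<delta> * (2 * E * (\<nu> * norm x)) \<le> \<delta> * (\<delta> * E\<^sup>2 + (\<nu> * norm x)\<^sup>2 / \<delta>)"
      using \<delta> by (simp add: power2_eq_square algebra_simps)
    then have "2 * E * (\<nu> * norm x) \<le> \<delta> * E\<^sup>2 + (\<nu> * norm x)\<^sup>2 / \<delta>"
      using \<delta> by (simp only: mult_le_cancel_left_pos)
    then have "(E + \<nu> * norm x)\<^sup>2 \<le> (1 + \<delta>) * E\<^sup>2 + (1 + 1 / \<delta>) * (\<nu> * norm x)\<^sup>2"
      by (simp add: power2_sum algebra_simps)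
    also have "\<dots> \<le> (1 + \<delta>) * (C\<^sup>2 * \<nu> * S) + (1 + 1 / \<delta>) * (\<nu> * norm x)\<^sup>2"
      using E2 \<delta> by simp
    also have "(1 + \<delta>) * (C\<^sup>2 * \<nu> * S) = \<kappa> * S"
      using \<mu> \<nu> C unfolding \<delta>_def \<kappa>_def by (simp add: field_simps power2_eq_square)
    also have "(1 + 1 / \<delta>) * (\<nu> * norm x)\<^sup>2 = \<kappa> * (\<mu> * (norm x)\<^sup>2)"
      using \<mu> \<nu> C unfolding \<delta>_def \<kappa>_def by (simp add: field_simps power2_eq_square)
    finally show "(E + \<nu> * norm x)\<^sup>2 \<le> \<kappa> * (S + \<mu> * (norm x)\<^sup>2)"
      by (simp add: algebra_simps)
  qed simp
  finally show "(pair h x t v)\<^sup>2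
      \<le> \<kappa> * ((norm z)\<^sup>2 / \<mu> - 2 * (blinfun_apply \<iota> h \<bullet> blinfun_apply \<iota> x)) * (norm v)\<^sup>2"
    by (simp add: S_def)
qed

end

section \<open>Solvability of the discrete adjoint problem and the duality argument\<close>

context symmetric_form begin

text \<open>Measurability of \<open>a\<close> is available only after applying it to a fixed vector,
  so the first argument is constant here; the second enters by continuity of evaluation.\<close>

lemma form_measurable:
  assumes "y \<in> borel_measurable (time_measure T)"
  shows "(\<lambda>t. form t v (y t)) \<in> borel_measurable (time_measure T)"
  by (rule borel_measurable_continuous_Pair[OF a_meas assms]) (intro continuous_intros)

text \<open>The moving vector \<open>y t\<close> stands in the first argument of the form. Symmetry
  brings \<open>x t\<close> there instead, and expanding it in a finite system leaves only fixed
  first arguments.\<close>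

lemma pair_measurable:
  assumes [measurable]: "h \<in> borel_measurable (time_measure T)" "x \<in> borel_measurable (time_measure T)"
    "y \<in> borel_measurable (time_measure T)"
    and x: "\<And>t. x t \<in> W"
  shows "(\<lambda>t. pair (h t) (x t) t (y t)) \<in> borel_measurable (time_measure T)"
proof -
  obtain I :: "'h set" and b where I: "finite I"
    and b: "\<And>w. w \<in> W \<Longrightarrow> w = (\<Sum>i\<in>I. (blinfun_apply \<iota> (b i) \<bullet> blinfun_apply \<iota> w) *\<^sub>R b i)"
    using orthonormal_pullback[of "blinfun_apply \<iota>" B] inj W(1,2) blinfun.bounded_linear_right
      bounded_linear.linear by metis
  have [measurable]: "blinfun_apply \<iota> \<in> borel_measurable borel"
    by (intro borel_measurable_continuous_onI continuous_intros)
  note form_measurable[measurable]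
  let ?g = "\<lambda>t. blinfun_apply \<iota> (h t) \<bullet> blinfun_apply \<iota> (y t)
      + (\<Sum>i\<in>I. (blinfun_apply \<iota> (b i) \<bullet> blinfun_apply \<iota> (x t)) * form t (b i) (y t))"
  have m: "?g \<in> borel_measurable (time_measure T)"
    by measurable
  have eq: "form t (y t) (x t)
      = (\<Sum>i\<in>I. (blinfun_apply \<iota> (b i) \<bullet> blinfun_apply \<iota> (x t)) * form t (b i) (y t))"
    if "t \<in> space (time_measure T)" for t
  proof -
    have "form t (y t) (x t) = form t (x t) (y t)" using a_sym that by simp
    also have "\<dots> = form t (\<Sum>i\<in>I. (blinfun_apply \<iota> (b i) \<bullet> blinfun_apply \<iota> (x t)) *\<^sub>R b i) (y t)"
      using b[OF x] by simp
    finally show ?thesis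
      by (simp add: blinfun.sum_right blinfun.sum_left blinfun.scaleR_right blinfun.scaleR_left)
  qed
  have "(\<lambda>t. pair (h t) (x t) t (y t)) \<in> borel_measurable (time_measure T)
      \<longleftrightarrow> ?g \<in> borel_measurable (time_measure T)"
    by (rule measurable_cong) (use eq in simp)
  with m show ?thesis by blast
qed

text \<open>In the system pulled back from H, the equation for \<open>h\<close> is solved explicitly
  by the sum of (z \<bullet> b_i - a(b_i, x)) b_i. Substituting this into x' = -h gives a Lipschitz
  backward differential equation, and the tested equation then holds at every time.\<close>

lemma discrete_adjoint_problem:
  assumes z: "z \<in> L2_space T norm W"
  obtains x h where "continuous_on UNIV x" "\<And>t. x t \<in> W" "\<And>t. h t \<in> W"
    "integrable (time_measure T) h" "x = tail_integral T h"
    "\<And>t v. v \<in> W \<Longrightarrow> pair (h t) (x t) t v = z t \<bullet> v"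
proof -
  let ?M = "time_measure T"
  obtain I :: "'h set" and b where I: "finite I" and bW: "\<And>i. i \<in> I \<Longrightarrow> b i \<in> W"
    and b: "\<And>w. w \<in> W \<Longrightarrow> w = (\<Sum>i\<in>I. (blinfun_apply \<iota> (b i) \<bullet> blinfun_apply \<iota> w) *\<^sub>R b i)"
    using orthonormal_pullback[of "blinfun_apply \<iota>" B] inj W(1,2) blinfun.bounded_linear_right
      bounded_linear.linear by metis
  note zm[measurable] = integrable_L2_space(1)[OF z]
  note zi = L2_space_integrable[OF z]
  define k where "k i s v = z s \<bullet> b i - form s (b i) v" for i s v
  define F where "F s v = (\<Sum>i\<in>I. k i s v *\<^sub>R b i)" for s v
  \<comment> \<open>The leading 1 keeps \<open>L\<close> positive even when the sum
    vanishes.\<close>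
  define L where "L = 1 + (\<Sum>i\<in>I. \<nu> * (norm (b i))\<^sup>2)"
  have L: "0 < L"
    unfolding L_def using \<nu> by (intro add_pos_nonneg sum_nonneg) auto
  have km: "(\<lambda>s. k i s (x s)) \<in> borel_measurable ?M" if "continuous_on UNIV x" for x i
  proof -
    have [measurable]: "x \<in> borel_measurable ?M"
      by (intro borel_measurable_time_measure borel_measurable_continuous_onI that)
    note form_measurable[measurable]
    show ?thesis unfolding k_def by measurable
  qed
  obtain x where x: "continuous_on UNIV x" "integrable ?M (\<lambda>s. F s (x s))"
    "\<And>t. x t = tail_integral T (\<lambda>s. F s (x s)) t"
  proof (rule backward_ode_exists[of F T L])
    show "(\<lambda>s. F s (x s)) \<in> borel_measurable ?M" if "continuous_on UNIV x" for x
      unfolding F_def by (intro borel_measurable_sum borel_measurable_scaleR km that) simp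
    show "0 < L" by (rule L)
    show "integrable ?M (\<lambda>s. F s 0)"
      unfolding F_def k_def using zi
      by (intro Bochner_Integration.integrable_sum integrable_scaleR_left) simp
    fix s v w assume s: "0 < s" "s < T"
    have "F s v - F s w = (\<Sum>i\<in>I. (- form s (b i) (v - w)) *\<^sub>R b i)"
      unfolding F_def k_def
      by (simp add: sum_subtractf[symmetric] scaleR_diff_left[symmetric] blinfun.diff_right)
    also have "norm \<dots> \<le> (\<Sum>i\<in>I. \<nu> * (norm (b i))\<^sup>2 * norm (v - w))"
    proof (rule sum_norm_le)
      fix i
      have "norm ((- form s (b i) (v - w)) *\<^sub>R b i) = \<bar>form s (b i) (v - w)\<bar> * norm (b i)" by simp
      also have "\<dots> \<le> (\<nu> * norm (b i) * norm (v - w)) * norm (b i)"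
        by (intro mult_right_mono a_bounded s) simp
      finally show "norm ((- form s (b i) (v - w)) *\<^sub>R b i) \<le> \<nu> * (norm (b i))\<^sup>2 * norm (v - w)"
        by (simp add: power2_eq_square mult_ac)
    qed
    also have "\<dots> \<le> L * norm (v - w)"
      unfolding L_def by (simp add: sum_distrib_right distrib_right)
    finally show "norm (F s v - F s w) \<le> L * norm (v - w)" .
  qed (rule that)
  obtain R where R: "\<And>s. 0 < s \<Longrightarrow> s < T \<Longrightarrow> norm (x s) \<le> R"
    using continuous_norm_bound_Ioo[OF x(1)] by metis
  \<comment> \<open>Each coefficient is needed separately to place the tail integral in
    \<open>W\<close>; boundedness of \<open>x\<close> on the time interval supplies it.\<close>
  have ki: "integrable ?M (\<lambda>s. k i s (x s))" for i
  proof -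
    have "integrable ?M (\<lambda>s. form s (b i) (x s))"
    proof (rule time.integrable_const_bound)
      show "(\<lambda>s. form s (b i) (x s)) \<in> borel_measurable ?M"
        by (intro form_measurable borel_measurable_time_measure borel_measurable_continuous_onI x)
      show "AE s in ?M. norm (form s (b i) (x s)) \<le> \<nu> * norm (b i) * R"
      proof (rule AE_I2)
        fix s assume "s \<in> space ?M"
        then have s: "0 < s" "s < T" by auto
        have "norm (form s (b i) (x s)) \<le> \<nu> * norm (b i) * norm (x s)"
          using a_bounded[OF s] by simp
        also have "\<dots> \<le> \<nu> * norm (b i) * R"
          using R[OF s] \<nu> by (intro mult_left_mono) auto
        finally show "norm (form s (b i) (x s)) \<le> \<nu> * norm (b i) * R" .
      qed
    qed
    then show ?thesis unfolding k_def using zi by simp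
  qed
  show ?thesis
  proof (rule that[of x "\<lambda>s. F s (x s)"])
    show "x = tail_integral T (\<lambda>s. F s (x s))" using x(3) by blast
    show "x t \<in> W" for t
      unfolding x(3)[of t] F_def by (rule tail_integral_in_subspace[OF I ki bW subspace_W])
    show "F t (x t) \<in> W" for t
      unfolding F_def by (intro subspace_sum subspace_scale subspace_W bW)
    fix t v assume v: "v \<in> W"
    let ?c = "\<lambda>i. blinfun_apply \<iota> (b i) \<bullet> blinfun_apply \<iota> v"
    have "blinfun_apply \<iota> (F t (x t)) \<bullet> blinfun_apply \<iota> v = (\<Sum>i\<in>I. k i t (x t) * ?c i)"
      unfolding F_def by (simp add: blinfun.sum_right blinfun.scaleR_right inner_sum_left)
    also have "\<dots> = z t \<bullet> (\<Sum>i\<in>I. ?c i *\<^sub>R b i) - form t (\<Sum>i\<in>I. ?c i *\<^sub>R b i) (x t)"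
      unfolding k_def
      by (simp add: inner_sum_right blinfun.sum_right blinfun.sum_left blinfun.scaleR_right
          blinfun.scaleR_left sum_subtractf[symmetric] algebra_simps)
    also have "(\<Sum>i\<in>I. ?c i *\<^sub>R b i) = v" using b[OF v] by simp
    finally show "pair (F t (x t)) (x t) t v = z t \<bullet> v" by simp
  qed (rule x(1,2))+
qed

text \<open>One dual solution \<open>x\<close>, with derivative \<open>- h\<close>, is admissible in
  both test spaces. Hence the adjoint form at (u - uh, x) vanishes, and every multiple of the error
  may be subtracted from \<open>z\<close>.\<close>

lemma discrete_stability:
  assumes u: "weak_solution T \<iota> a f u0 u" and uh: "discrete_solution T \<iota> a f u0 W uh"
    and z: "z \<in> L2_space T norm W"
  shows "(\<integral>t. (norm (z t))\<^sup>2 \<partial>time_measure T)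
    \<le> (C * (1 + \<nu> / \<mu>))\<^sup>2 * (\<integral>t. (norm (z t - s *\<^sub>R (u t - uh t)))\<^sup>2 \<partial>time_measure T)"
proof -
  let ?M = "time_measure T"
  obtain x h where x: "continuous_on UNIV x" "\<And>t. x t \<in> W" and hW: "\<And>t. h t \<in> W"
    and h: "integrable ?M h" and xh: "x = tail_integral T h"
    and eq: "\<And>t v. v \<in> W \<Longrightarrow> pair (h t) (x t) t v = z t \<bullet> v"
    using discrete_adjoint_problem[OF z] by metis
  have uL: "u \<in> L2_space T norm UNIV" and uhL: "uh \<in> L2_space T norm W"
    using u uh unfolding weak_solution_def discrete_solution_def by blast+
  note [measurable] = integrable_L2_space(1)[OF uL] integrable_L2_space(1)[OF uhL] integrable_L2_space(1)[OF z]
  have xm[measurable]: "x \<in> borel_measurable ?M"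
    by (intro borel_measurable_time_measure borel_measurable_continuous_onI x)
  have hm[measurable]: "h \<in> borel_measurable ?M" using h by auto
  have [measurable]: "blinfun_apply \<iota> \<in> borel_measurable borel"
    by (intro borel_measurable_continuous_onI continuous_intros)
  obtain R where R: "\<And>t. 0 < t \<Longrightarrow> t < T \<Longrightarrow> norm (x t) \<le> R"
    using continuous_norm_bound_Ioo[OF x(1)] by metis
  define q where "q t = blinfun_apply \<iota> (h t) \<bullet> blinfun_apply \<iota> (x t)" for t
  \<comment> \<open>The pointwise majorant of the squared pairing and derivative, up to constants.
    Its integral is at most that of |z|^2 / \<mu>, because \<open>q\<close> has nonnegative
    integral.\<close>
  define S where "S t = (norm (z t))\<^sup>2 / \<mu> - 2 * q t" for t
  have \<iota>h: "integrable ?M (\<lambda>t. blinfun_apply \<iota> (h t))"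
    by (rule integrable_bounded_linear[OF blinfun.bounded_linear_right h])
  have \<iota>x: "blinfun_apply \<iota> (x t) = tail_integral T (\<lambda>t. blinfun_apply \<iota> (h t)) t" for t
    unfolding xh by (rule bounded_linear_tail_integral[OF blinfun.bounded_linear_right h, symmetric])
  have qi: "integrable ?M q"
  proof (rule Bochner_Integration.integrable_bound)
    show "integrable ?M (\<lambda>t. norm (blinfun_apply \<iota> (h t)) * (norm \<iota> * R))"
      using \<iota>h by simp
    show "AE t in ?M. norm (q t) \<le> norm (norm (blinfun_apply \<iota> (h t)) * (norm \<iota> * R))"
      using AE_time_measure
    proof eventually_elim
      case (elim t)
      have "norm (q t) \<le> norm (blinfun_apply \<iota> (h t)) * norm (blinfun_apply \<iota> (x t))"
        unfolding q_def by (simp add: Cauchy_Schwarz_ineq2)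
      also have "\<dots> \<le> norm (blinfun_apply \<iota> (h t)) * (norm \<iota> * R)"
        using R[of t] elim by (intro mult_left_mono order_trans[OF norm_blinfun]) auto
      finally show ?case by simp
    qed
    show "q \<in> borel_measurable ?M" unfolding q_def by measurable
  qed
  \<comment> \<open>This integral is half the squared H-norm of \<open>x 0\<close>, a boundary term
    with the favourable sign.\<close>
  have q0: "0 \<le> (\<integral>t. q t \<partial>?M)"
    unfolding q_def \<iota>x by (subst integral_inner_tail_integral[OF \<iota>h]) simp
  have zi: "integrable ?M (\<lambda>t. (norm (z t))\<^sup>2)" by (rule integrable_L2_space(2)[OF z])
  have Si: "integrable ?M S"
    unfolding S_def using zi qi by simp
  have bound: "(pair (h t) (x t) t v)\<^sup>2 \<le> \<kappa> * S t * (norm v)\<^sup>2"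
    "(norm (dual_embed \<iota> (blinfun_apply \<iota> (h t))))\<^sup>2 \<le> C\<^sup>2 * \<nu> * S t"
    "(dual_norm_on \<iota> W (h t))\<^sup>2 \<le> \<nu> * S t"
    if "0 < t" "t < T" for t v
  proof -
    show "(pair (h t) (x t) t v)\<^sup>2 \<le> \<kappa> * S t * (norm v)\<^sup>2"
      "(norm (dual_embed \<iota> (blinfun_apply \<iota> (h t))))\<^sup>2 \<le> C\<^sup>2 * \<nu> * S t"
      using pair_norm_pointwise[OF that x(2) hW eq] by (simp_all add: S_def q_def)
    have "\<nu> * ((norm (z t))\<^sup>2 / \<mu> - \<mu> * (norm (x t))\<^sup>2 - 2 * q t) \<le> \<nu> * S t"
      unfolding S_def using \<mu> \<nu> by (intro mult_left_mono) auto
    then show "(dual_norm_on \<iota> W (h t))\<^sup>2 \<le> \<nu> * S t"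
      using dual_norm_pointwise[OF that x(2) eq] by (simp add: q_def)
  qed
  have pm: "(\<lambda>t. pair (h t) (x t) t (y t)) \<in> borel_measurable ?M" if "y \<in> L2_space T norm W'" for y W'
    by (rule pair_measurable[OF hm xm integrable_L2_space(1)[OF that] x(2)])
  \<comment> \<open>Applied with \<open>\<epsilon> = 1\<close> for integrability and with
    \<open>\<epsilon> = K\<^sup>2\<close> in the final estimate.\<close>
  have young: "norm (pair (h t) (x t) t v) \<le> (\<epsilon> * (norm v)\<^sup>2 + \<kappa> * S t / \<epsilon>) / 2"
    if t: "0 < t" "t < T" and "0 < \<epsilon>" for t v \<epsilon>
  proof -
    have S: "0 \<le> \<kappa> * S t" 
    proof (cases "\<forall>v :: 'v. v = 0")
      case True
      with W(3) subspace_0[OF subspace_W] show ?thesis by auto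
    next
      case False
      then obtain v :: 'v where "v \<noteq> 0" by blast
      then show ?thesis
        using order_trans[OF zero_le_power2 bound(1)[OF t, of v]] by (simp add: zero_le_mult_iff)
    qed
    have "sqrt ((pair (h t) (x t) t v)\<^sup>2) \<le> sqrt ((\<kappa> * S t / \<epsilon>) * (\<epsilon> * (norm v)\<^sup>2))"
      using bound(1)[OF t, of v] that(3) by (intro real_sqrt_le_mono) simp
    also have "\<dots> \<le> (\<kappa> * S t / \<epsilon> + \<epsilon> * (norm v)\<^sup>2) / 2"
      by (rule arith_geo_mean_sqrt) (use S that(3) in auto)
    finally show ?thesis by (simp add: add.commute)
  qed
  have pi: "integrable ?M (\<lambda>t. pair (h t) (x t) t (y t))" if "y \<in> L2_space T norm W'" for y W'
  proof (rule Bochner_Integration.integrable_bound[OF _ pm[OF that]])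
    show "integrable ?M (\<lambda>t. (1 * (norm (y t))\<^sup>2 + \<kappa> * S t / 1) / 2)"
      using Si integrable_L2_space(2)[OF that] by simp
    show "AE t in ?M. norm (pair (h t) (x t) t (y t)) \<le> norm ((1 * (norm (y t))\<^sup>2 + \<kappa> * S t / 1) / 2)"
      using AE_time_measure
    proof eventually_elim
      case (elim t)
      then show ?case using order_trans[OF young[of t 1 "y t"] abs_ge_self] by simp
    qed
  qed
  define xc where "xc t = blinfun_apply \<iota> (x t)" for t
  have xL: "x \<in> L2_space T norm W"
  proof (rule L2_spaceI[where B = "\<lambda>_. R\<^sup>2"])
    show "AE t in ?M. (norm (x t))\<^sup>2 \<le> R\<^sup>2"
      using AE_time_measure by eventually_elim (use R in \<open>auto intro!: power_mono\<close>)
  qed (use x(2) in auto)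
  have xT: "x T = 0" unfolding xh by (rule tail_integral_end)
  have xcc: "continuous_on {0..T} xc"
    unfolding xc_def by (intro continuous_intros continuous_on_subset[OF x(1)]) auto
  have disc: "(x, \<lambda>t. - h t, xc) \<in> discrete_test_space T \<iota> W"
  proof -
    have "weak_time_deriv T x (\<lambda>t. - h t)"
      unfolding xh by (rule weak_time_deriv_tail_integral[OF h])
    moreover have "(\<lambda>t. - h t) \<in> L2_space T (dual_norm_on \<iota> W) W"
    proof (rule L2_spaceI[where B = "\<lambda>t. \<nu> * S t"])
      \<comment> \<open>The unit sphere of \<open>W\<close> is symmetric, so the bound for
        \<open>h\<close> carries over to \<open>- h\<close>.\<close>
      have sym: "dual_norm_on \<iota> W (- v) = dual_norm_on \<iota> W v" for v
      proof -
        have "(\<lambda>w. blinfun_apply \<iota> (- v) \<bullet> blinfun_apply \<iota> w) ` {w \<in> W. norm w = 1}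
          = (\<lambda>w. blinfun_apply \<iota> v \<bullet> blinfun_apply \<iota> w) ` uminus ` {w \<in> W. norm w = 1}"
          unfolding image_image by (simp add: blinfun.minus_right)
        also have "uminus ` {w \<in> W. norm w = 1} = {w \<in> W. norm w = 1}"
          using subspace_neg[OF subspace_W] by (auto intro!: image_eqI[where x = "- w" for w])
        finally show ?thesis unfolding dual_norm_on_def by simp
      qed
      show "AE t in ?M. (dual_norm_on \<iota> W (- h t))\<^sup>2 \<le> \<nu> * S t"
        unfolding sym using AE_time_measure by eventually_elim (use bound(3) in auto)
      show "AE t in ?M. - h t \<in> W"
        using hW subspace_neg[OF subspace_W] by simp
    qed (use Si in auto)
    ultimately show ?thesis
      unfolding discrete_test_space_def using xL xcc xT by (simp add: xc_def)
  qed
  \<comment> \<open>The embedding into the dual is bounded and linear, hence commutes with the tail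
    integral and turns the derivative of \<open>x\<close> in V into the one in the dual
    space.\<close>
  have cont: "(x, \<lambda>t. dual_embed \<iota> (blinfun_apply \<iota> (- h t)), xc) \<in> adjoint_test_space T \<iota>"
  proof -
    let ?J = "\<lambda>v. dual_embed \<iota> (blinfun_apply \<iota> v)"
    have Jh: "integrable ?M (\<lambda>t. ?J (h t))"
      by (rule integrable_bounded_linear[OF bounded_linear_dual_embed h])
    have "weak_time_deriv T (tail_integral T (\<lambda>t. ?J (h t))) (\<lambda>t. - ?J (h t))"
      by (rule weak_time_deriv_tail_integral[OF Jh])
    moreover have "tail_integral T (\<lambda>t. ?J (h t)) = (\<lambda>t. ?J (x t))"
      unfolding xh by (intro ext bounded_linear_tail_integral[OF bounded_linear_dual_embed h])
    moreover have J: "- ?J v = ?J (- v)" for v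
      using linear_simps(4)[OF bounded_linear_dual_embed, of \<iota> v] by simp
    ultimately have "weak_time_deriv T (\<lambda>t. ?J (x t)) (\<lambda>t. ?J (- h t))"
      by simp
    moreover have "(\<lambda>t. ?J (- h t)) \<in> L2_space T norm UNIV"
    proof (rule L2_spaceI[where B = "\<lambda>t. C\<^sup>2 * \<nu> * S t"])
      show "AE t in ?M. (norm (?J (- h t)))\<^sup>2 \<le> C\<^sup>2 * \<nu> * S t"
        unfolding J[symmetric] norm_minus_cancel
        using AE_time_measure by eventually_elim (use bound(2) in auto)
      show "(\<lambda>t. ?J (- h t)) \<in> borel_measurable ?M"
        unfolding J[symmetric] using Jh by auto
    qed (use Si in auto)
    moreover have "x \<in> L2_space T norm UNIV"
      using xL by (auto simp: L2_space_def)
    ultimately show ?thesis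
      unfolding adjoint_test_space_def using xcc xT by (simp add: xc_def)
  qed
  have "adjoint_form T a u x (\<lambda>t. dual_embed \<iota> (blinfun_apply \<iota> (- h t)))
      = load_functional T f u0 x xc"
    using bspec[OF conjunct2[OF u[unfolded weak_solution_def]] cont] by (simp only: prod.case)
  moreover have "adjoint_form T a uh x (\<lambda>t. dual_embed \<iota> (blinfun_apply \<iota> (- h t)))
      = load_functional T f u0 x xc"
    using bspec[OF conjunct2[OF uh[unfolded discrete_solution_def]] disc] by (simp only: prod.case)
  moreover have "adjoint_form T a y x (\<lambda>t. dual_embed \<iota> (blinfun_apply \<iota> (- h t)))
      = (\<integral>t. pair (h t) (x t) t (y t) \<partial>?M)" for y
    unfolding adjoint_form_def by (simp add: blinfun.minus_left blinfun.minus_right)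
  ultimately have orth: "(\<integral>t. pair (h t) (x t) t (u t) \<partial>?M) = (\<integral>t. pair (h t) (x t) t (uh t) \<partial>?M)"
    by simp
  define K where "K = C * (1 + \<nu> / \<mu>)"
  have K: "0 < K"
    unfolding K_def using C \<mu> \<nu> by (intro mult_pos_pos add_pos_pos) auto
  define v where "v t = z t - s *\<^sub>R (u t - uh t)" for t
  have "(\<lambda>t. u t - 1 *\<^sub>R uh t) \<in> L2_space T norm UNIV"
    by (rule L2_space_diff_scale[OF uL uhL])
  then have vL: "v \<in> L2_space T norm UNIV"
    unfolding v_def using L2_space_diff_scale[OF z, of "\<lambda>t. u t - uh t" UNIV s] by simp
  have "(\<integral>t. (norm (z t))\<^sup>2 \<partial>?M) = (\<integral>t. pair (h t) (x t) t (z t) \<partial>?M)"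
  proof (rule integral_cong_AE[OF _ pm[OF z]])
    have "AE t in ?M. z t \<in> W" using z by (simp add: L2_space_def)
    then show "AE t in ?M. (norm (z t))\<^sup>2 = pair (h t) (x t) t (z t)"
      by eventually_elim (simp add: eq power2_norm_eq_inner)
  qed simp
  also have "\<dots> = (\<integral>t. pair (h t) (x t) t (v t) \<partial>?M)"
  proof -
    have "(\<integral>t. pair (h t) (x t) t (v t) \<partial>?M)
        = (\<integral>t. pair (h t) (x t) t (z t) - s * (pair (h t) (x t) t (u t) - pair (h t) (x t) t (uh t)) \<partial>?M)"
      unfolding v_def
      by (simp add: blinfun.diff_right blinfun.diff_left blinfun.scaleR_right blinfun.scaleR_left
          blinfun.add_right blinfun.add_left inner_diff_right inner_add_right algebra_simps)
    also have "\<dots> = (\<integral>t. pair (h t) (x t) t (z t) \<partial>?M)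
        - s * ((\<integral>t. pair (h t) (x t) t (u t) \<partial>?M) - (\<integral>t. pair (h t) (x t) t (uh t) \<partial>?M))"
      using pi[OF z] pi[OF uL] pi[OF uhL]
      by (simp only: Bochner_Integration.integral_diff Bochner_Integration.integrable_diff
          integral_mult_right_zero integrable_mult_right)
    finally show ?thesis using orth by simp
  qed
  \<comment> \<open>With the weight \<open>K\<^sup>2\<close> the term with \<open>S\<close> costs at
    most half of the left side and is absorbed there.\<close>
  also have "\<dots> \<le> (\<integral>t. (K\<^sup>2 * (norm (v t))\<^sup>2 + \<kappa> * S t / K\<^sup>2) / 2 \<partial>?M)"
  proof (rule integral_mono_AE[OF pi[OF vL]])
    show "integrable ?M (\<lambda>t. (K\<^sup>2 * (norm (v t))\<^sup>2 + \<kappa> * S t / K\<^sup>2) / 2)"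
      using integrable_L2_space(2)[OF vL] Si by simp
    show "AE t in ?M. pair (h t) (x t) t (v t) \<le> (K\<^sup>2 * (norm (v t))\<^sup>2 + \<kappa> * S t / K\<^sup>2) / 2"
      using AE_time_measure
    proof eventually_elim
      case (elim t)
      then show ?case using order_trans[OF abs_ge_self young[of t "K\<^sup>2" "v t", unfolded real_norm_def]] K by simp
    qed
  qed
  also have "\<dots> = (K\<^sup>2 * (\<integral>t. (norm (v t))\<^sup>2 \<partial>?M) + \<kappa> * (\<integral>t. S t \<partial>?M) / K\<^sup>2) / 2"
    using integrable_L2_space(2)[OF vL] Si by simp
  also have "\<dots> \<le> (K\<^sup>2 * (\<integral>t. (norm (v t))\<^sup>2 \<partial>?M) + (\<integral>t. (norm (z t))\<^sup>2 \<partial>?M)) / 2"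
  proof -
    have "(\<integral>t. S t \<partial>?M) = (\<integral>t. (norm (z t))\<^sup>2 \<partial>?M) / \<mu> - 2 * (\<integral>t. q t \<partial>?M)"
      unfolding S_def using zi qi by simp
    also have "\<dots> \<le> (\<integral>t. (norm (z t))\<^sup>2 \<partial>?M) / \<mu>" using q0 by simp
    finally have "\<kappa> * (\<integral>t. S t \<partial>?M) \<le> \<kappa> * ((\<integral>t. (norm (z t))\<^sup>2 \<partial>?M) / \<mu>)"
      by (rule mult_left_mono) (use \<kappa>(1) in simp)
    also have "\<dots> \<le> (\<mu> * K\<^sup>2) * ((\<integral>t. (norm (z t))\<^sup>2 \<partial>?M) / \<mu>)"
      using \<kappa>(2) \<mu> unfolding K_def by (intro mult_right_mono) auto
    also have "\<dots> = K\<^sup>2 * (\<integral>t. (norm (z t))\<^sup>2 \<partial>?M)" using \<mu> by simp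
    finally have "\<kappa> * (\<integral>t. S t \<partial>?M) / K\<^sup>2 \<le> (\<integral>t. (norm (z t))\<^sup>2 \<partial>?M)"
      using K by (simp add: field_simps)
    then show ?thesis by (intro divide_right_mono add_left_mono) auto
  qed
  finally show ?thesis unfolding K_def v_def by simp
qed

end

section \<open>Quasi-optimality for a fixed sample\<close>

lemma L2_norm_eq_sqrt:
  assumes "y \<in> L2_space T norm W"
  shows "L2_norm T y = ennreal (sqrt (\<integral>t. (norm (y t))\<^sup>2 \<partial>time_measure T))"
  unfolding L2_norm_def
  by (subst nn_integral_eq_integral[OF integrable_L2_space(2)[OF assms]])
    (auto simp: epowr_def powr_half_sqrt)

text \<open>The argument of Kato and of Xu and Zikatanov for \<open>\<parallel>I - P\<parallel> = \<parallel>P\<parallel>\<close>: exchanging the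
  norms of \<open>e\<close> and \<open>z\<close> by rescaling leaves \<open>\<parallel>e - z\<parallel>\<close> unchanged.\<close>

lemma rescaled_projection_bound:
  fixes e z :: "real \<Rightarrow> 'a::{real_inner,banach,second_countable_topology}"
  assumes e: "e \<in> L2_space T norm UNIV" and z: "z \<in> L2_space T norm W" and K: "1 \<le> K"
    and bound: "\<And>s. (\<integral>t. (norm (z t))\<^sup>2 \<partial>time_measure T)
      \<le> K\<^sup>2 * (\<integral>t. (norm (z t - s *\<^sub>R e t))\<^sup>2 \<partial>time_measure T)"
  shows "(\<integral>t. (norm (e t))\<^sup>2 \<partial>time_measure T) \<le> K\<^sup>2 * (\<integral>t. (norm (e t - z t))\<^sup>2 \<partial>time_measure T)"
proof -
  let ?M = "time_measure T"
  note ei = integrable_L2_space[OF e] and zi = integrable_L2_space[OF z]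
  note [measurable] = ei(1) zi(1)
  have zei: "integrable ?M (\<lambda>t. z t \<bullet> e t)"
  proof (rule Bochner_Integration.integrable_bound)
    show "integrable ?M (\<lambda>t. (norm (z t))\<^sup>2 + (norm (e t))\<^sup>2)" using ei zi by simp
    show "AE t in ?M. norm (z t \<bullet> e t) \<le> norm ((norm (z t))\<^sup>2 + (norm (e t))\<^sup>2)"
    proof (rule AE_I2)
      fix t
      have "norm (z t \<bullet> e t) \<le> norm (z t) * norm (e t)"
        by (simp add: Cauchy_Schwarz_ineq2)
      also have "\<dots> \<le> 2 * norm (z t) * norm (e t)" by simp
      also have "\<dots> \<le> (norm (z t))\<^sup>2 + (norm (e t))\<^sup>2" by (rule sum_squares_bound)
      finally show "norm (z t \<bullet> e t) \<le> norm ((norm (z t))\<^sup>2 + (norm (e t))\<^sup>2)" by simp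
    qed
  qed simp
  define m n i where "m = (\<integral>t. (norm (e t))\<^sup>2 \<partial>?M)" and "n = (\<integral>t. (norm (z t))\<^sup>2 \<partial>?M)"
    and "i = (\<integral>t. z t \<bullet> e t \<partial>?M)"
  have expand: "(\<integral>t. (norm (z t - s *\<^sub>R e t))\<^sup>2 \<partial>?M) = n - 2 * s * i + s\<^sup>2 * m" for s
  proof -
    have "(norm (z t - s *\<^sub>R e t))\<^sup>2 = (norm (z t))\<^sup>2 - 2 * s * (z t \<bullet> e t) + s\<^sup>2 * (norm (e t))\<^sup>2" for t
      unfolding power2_norm_eq_inner
      by (simp add: inner_diff inner_commute power2_eq_square algebra_simps)
    then show ?thesis
      unfolding m_def n_def i_def using ei zi zei by simp
  qed
  have ez: "(\<integral>t. (norm (e t - z t))\<^sup>2 \<partial>?M) = n - 2 * i + m"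
    using expand[of 1] by (simp add: norm_minus_commute)
  have nn: "0 \<le> m" "0 \<le> n" "0 \<le> (\<integral>t. (norm (e t - z t))\<^sup>2 \<partial>?M)"
    unfolding m_def n_def by simp_all
  have "m \<le> K\<^sup>2 * (\<integral>t. (norm (e t - z t))\<^sup>2 \<partial>?M)"
  proof (cases "m = 0 \<or> n = 0")
    case True
    then show ?thesis
    proof
      assume "m = 0"
      then show ?thesis using nn by simp
    next
      \<comment> \<open>Here \<open>z\<close> vanishes almost everywhere and the claim becomes m
        \<le> K^2 m, where \<open>1 \<le> K\<close> is used.\<close>
      assume "n = 0"
      then have "AE t in ?M. z t = 0"
        using zi(2) unfolding n_def by (subst (asm) integral_nonneg_eq_0_iff_AE) auto
      then have "(\<integral>t. z t \<bullet> e t \<partial>?M) = (\<integral>t. 0 \<partial>?M)"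
        by (intro integral_cong_AE) auto
      then have "i = 0" by (simp add: i_def)
      with \<open>n = 0\<close> have "(\<integral>t. (norm (e t - z t))\<^sup>2 \<partial>?M) = m" by (simp add: ez)
      then show ?thesis
        using K nn mult_right_mono[of 1 "K\<^sup>2" m] by simp
    qed
  next
    case False
    with nn have pos: "0 < m" "0 < n" by auto
    \<comment> \<open>For s = n / m the squared norm of z - s e equals n / m times that of e -
      z.\<close>
    have "n \<le> K\<^sup>2 * (n - 2 * (n / m) * i + (n / m)\<^sup>2 * m)"
      using bound[of "n / m"] unfolding expand n_def[symmetric] .
    also have "n - 2 * (n / m) * i + (n / m)\<^sup>2 * m = (n / m) * (n - 2 * i + m)"
      using pos by (simp add: power2_eq_square field_simps)
    finally have "m * n \<le> n * (K\<^sup>2 * (n - 2 * i + m))"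
      using pos by (simp add: field_simps)
    then have "m \<le> K\<^sup>2 * (n - 2 * i + m)"
      using pos by (simp add: mult.commute)
    then show ?thesis unfolding ez .
  qed
  then show ?thesis unfolding m_def .
qed

text \<open>Take e = u - uh and z = y - uh. Then \<open>z\<close> is \<open>W\<close>-valued almost
  everywhere, as stability demands, and e - z = u - y.\<close>

lemma (in symmetric_form) quasi_optimal:
  assumes u: "weak_solution T \<iota> a f u0 u" and uh: "discrete_solution T \<iota> a f u0 W uh"
    and y: "y \<in> L2_space T norm W"
  shows "L2_norm T (u - uh) \<le> ennreal (C * (1 + \<nu> / \<mu>)) * L2_norm T (u - y)"
proof -
  have uL: "u \<in> L2_space T norm UNIV" and uhL: "uh \<in> L2_space T norm W"
    using u uh unfolding weak_solution_def discrete_solution_def by blast+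
  have e: "(\<lambda>t. u t - uh t) \<in> L2_space T norm UNIV" "(\<lambda>t. u t - y t) \<in> L2_space T norm UNIV"
    using L2_space_diff_scale[OF uL uhL, of 1] L2_space_diff_scale[OF uL y, of 1] by simp_all
  have z: "(\<lambda>t. y t - uh t) \<in> L2_space T norm W"
  proof -
    have "AE t in time_measure T. y t - uh t \<in> W"
      using y uhL unfolding L2_space_def by (auto elim!: eventually_elim2 intro: subspace_diff[OF subspace_W])
    then show ?thesis
      using L2_space_diff_scale[OF y uhL, of 1] by (simp add: L2_space_def)
  qed
  define K where "K = C * (1 + \<nu> / \<mu>)"
  have "1 * 1 \<le> K"
    unfolding K_def using C(2) \<mu> \<nu> by (intro mult_mono) auto
  then have K: "1 \<le> K" by simp
  have "(\<integral>t. (norm (u t - uh t))\<^sup>2 \<partial>time_measure T)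
      \<le> K\<^sup>2 * (\<integral>t. (norm ((u t - uh t) - (y t - uh t)))\<^sup>2 \<partial>time_measure T)"
    using rescaled_projection_bound[OF e(1) z K] discrete_stability[OF u uh z] unfolding K_def by blast
  then have "sqrt (\<integral>t. (norm (u t - uh t))\<^sup>2 \<partial>time_measure T)
      \<le> sqrt (K\<^sup>2 * (\<integral>t. (norm (u t - y t))\<^sup>2 \<partial>time_measure T))"
    by simp
  also have "\<dots> = K * sqrt (\<integral>t. (norm (u t - y t))\<^sup>2 \<partial>time_measure T)"
    using K by (simp add: real_sqrt_mult)
  finally have "ennreal (sqrt (\<integral>t. (norm (u t - uh t))\<^sup>2 \<partial>time_measure T))
      \<le> ennreal K * ennreal (sqrt (\<integral>t. (norm (u t - y t))\<^sup>2 \<partial>time_measure T))"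
    using K by (simp add: ennreal_mult[symmetric] ennreal_leI)
  then show ?thesis
    using L2_norm_eq_sqrt[OF e(1)] L2_norm_eq_sqrt[OF e(2)] unfolding K_def fun_diff_def by simp
qed

section \<open>Norms over the sample space\<close>

lemma epowr_mono: "x \<le> y \<Longrightarrow> 0 \<le> r \<Longrightarrow> epowr x r \<le> epowr y r"
  unfolding epowr_def
  by (auto simp: top_unique intro!: ennreal_leI powr_mono2 enn2real_mono simp: less_top)

lemma epowr_cmult:
  assumes "0 < K"
  shows "epowr (ennreal K * x) r = ennreal (K powr r) * epowr x r"
  using assms by (cases x)
    (auto simp: epowr_def ennreal_mult[symmetric] powr_mult ennreal_mult_eq_top_iff ennreal_mult_top)

text \<open>Moving the constant to the left side, as multiplication by its inverse, leaves a plain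
  lower bound for the infimum.\<close>

lemma le_cmult_INF:
  fixes a :: ennreal
  assumes "0 < K" "\<And>y. y \<in> S \<Longrightarrow> a \<le> ennreal K * g y"
  shows "a \<le> ennreal K * (INF y\<in>S. g y)"
proof -
  have K: "ennreal K * ennreal (inverse K) = 1"
    using assms(1) by (simp add: ennreal_mult[symmetric])
  have "ennreal (inverse K) * a \<le> (INF y\<in>S. g y)"
  proof (rule INF_greatest)
    fix y assume "y \<in> S"
    then have "ennreal (inverse K) * a \<le> ennreal (inverse K) * (ennreal K * g y)"
      by (intro mult_left_mono assms) auto
    also have "\<dots> = g y" using K by (simp add: mult.assoc[symmetric] mult.commute)
    finally show "ennreal (inverse K) * a \<le> g y" .
  qed
  then have "ennreal K * (ennreal (inverse K) * a) \<le> ennreal K * (INF y\<in>S. g y)"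
    by (rule mult_left_mono) simp
  with K show ?thesis by (simp add: mult.assoc[symmetric])
qed

text \<open>No measurability is assumed, so only the lower integral is available.\<close>

lemma nn_integral_cmult_le:
  assumes "0 < K"
  shows "(\<integral>\<^sup>+\<omega>. ennreal K * g \<omega> \<partial>M) \<le> ennreal K * (\<integral>\<^sup>+\<omega>. g \<omega> \<partial>M)"
proof -
  have K: "ennreal K * ennreal (inverse K) = 1"
    using assms by (simp add: ennreal_mult[symmetric])
  have "integral\<^sup>S M s \<le> ennreal K * (\<integral>\<^sup>+\<omega>. g \<omega> \<partial>M)"
    if s: "simple_function M s" "s \<le> (\<lambda>\<omega>. ennreal K * g \<omega>)" for s
  proof -
    have m: "s \<in> borel_measurable M" by (rule borel_measurable_simple_function[OF s(1)])
    have "ennreal (inverse K) * s \<omega> \<le> g \<omega>" for \<omega>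
    proof -
      have "ennreal (inverse K) * s \<omega> \<le> ennreal (inverse K) * (ennreal K * g \<omega>)"
        using s(2) by (intro mult_left_mono) (auto simp: le_fun_def)
      also have "\<dots> = g \<omega>" using K by (simp add: mult.assoc[symmetric] mult.commute)
      finally show ?thesis .
    qed
    then have "ennreal K * (\<integral>\<^sup>+\<omega>. ennreal (inverse K) * s \<omega> \<partial>M) \<le> ennreal K * (\<integral>\<^sup>+\<omega>. g \<omega> \<partial>M)"
      by (intro mult_left_mono nn_integral_mono) auto
    also have "(\<integral>\<^sup>+\<omega>. ennreal (inverse K) * s \<omega> \<partial>M) = ennreal (inverse K) * integral\<^sup>N M s"
      by (rule nn_integral_cmult[OF m])
    finally show ?thesis
      using K nn_integral_eq_simple_integral[OF s(1)] by (simp add: mult.assoc[symmetric])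
  qed
  then show ?thesis
    unfolding nn_integral_def[of M "\<lambda>\<omega>. ennreal K * g \<omega>"] by (auto intro!: SUP_least)
qed

text \<open>The null set in \<open>bound\<close> is common to all \<open>y\<close>, so the infimum
  can be taken for each \<omega> before integrating. Nontriviality of \<open>M\<close> makes the
  almost-everywhere filter proper, which lets the constant pass through \<open>Limsup\<close> when p
  is infinite.\<close>

lemma Lp_norm_le_expected_best_error:
  assumes nontriv: "emeasure M (space M) \<noteq> 0" and p: "0 < p" and K: "0 < K"
    and bound: "AE \<omega> in M. \<forall>y\<in>Lp_space M p (L2_norm T) Y.
      L2_norm T (e \<omega>) \<le> ennreal K * L2_norm T (u \<omega> - y \<omega>)"
  shows "Lp_norm M p (\<lambda>\<omega>. L2_norm T (e \<omega>)) \<le> ennreal K * expected_best_error M p T Y u"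
proof (cases "p = \<top>")
  case True
  let ?g = "\<lambda>\<omega>. INF y\<in>Lp_space M p (L2_norm T) Y. L2_norm T (u \<omega> - y \<omega>)"
  have "Limsup (ae_filter M) (\<lambda>\<omega>. L2_norm T (e \<omega>)) \<le> Limsup (ae_filter M) (\<lambda>\<omega>. ennreal K * ?g \<omega>)"
    by (rule Limsup_mono, use bound in eventually_elim) (auto intro!: le_cmult_INF K)
  also have "\<dots> = ennreal K * Limsup (ae_filter M) ?g"
  proof (rule Limsup_compose_continuous_mono[where f = "\<lambda>x. ennreal K * x"])
    show "continuous_on UNIV (\<lambda>x. ennreal K * x)"
      by (intro ennreal_continuous_on_cmult continuous_on_id) simp
    show "mono (\<lambda>x. ennreal K * x)" by (auto intro!: monoI mult_left_mono)
    show "ae_filter M \<noteq> bot" using nontriv by (simp add: ae_filter_eq_bot_iff)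
  qed
  finally show ?thesis using True by (simp add: Lp_norm_def expected_best_error_def)
next
  case False
  define r where "r = enn2real p"
  have r: "0 < r" unfolding r_def using p False by (simp add: enn2real_positive_iff less_top)
  let ?g = "\<lambda>\<omega>. INF y\<in>Lp_space M p (L2_norm T) Y. epowr (L2_norm T (u \<omega> - y \<omega>)) r"
  have Kr: "0 < K powr r" using K by simp
  have "(\<integral>\<^sup>+\<omega>. epowr (L2_norm T (e \<omega>)) r \<partial>M) \<le> (\<integral>\<^sup>+\<omega>. ennreal (K powr r) * ?g \<omega> \<partial>M)"
  proof (rule nn_integral_mono_AE, use bound in eventually_elim)
    case (elim \<omega>)
    show ?case
    proof (rule le_cmult_INF[OF Kr])
      fix y assume "y \<in> Lp_space M p (L2_norm T) Y"
      with elim have "epowr (L2_norm T (e \<omega>)) r \<le> epowr (ennreal K * L2_norm T (u \<omega> - y \<omega>)) r"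
        using r by (intro epowr_mono) auto
      then show "epowr (L2_norm T (e \<omega>)) r \<le> ennreal (K powr r) * epowr (L2_norm T (u \<omega> - y \<omega>)) r"
        by (simp add: epowr_cmult[OF K])
    qed
  qed
  also have "\<dots> \<le> ennreal (K powr r) * (\<integral>\<^sup>+\<omega>. ?g \<omega> \<partial>M)"
    by (rule nn_integral_cmult_le[OF Kr])
  finally have "epowr (\<integral>\<^sup>+\<omega>. epowr (L2_norm T (e \<omega>)) r \<partial>M) (1 / r)
      \<le> epowr (ennreal (K powr r) * (\<integral>\<^sup>+\<omega>. ?g \<omega> \<partial>M)) (1 / r)"
    using r by (intro epowr_mono) auto
  also have "\<dots> = ennreal K * epowr (\<integral>\<^sup>+\<omega>. ?g \<omega> \<partial>M) (1 / r)"
    using r K by (simp add: epowr_cmult powr_powr)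
  finally show ?thesis using False by (simp add: Lp_norm_def expected_best_error_def r_def)
qed

text \<open>Joint measurability at the final time \<open>T\<close> restricts to each path, which
  gives the measurability in time required by the estimates for a fixed sample.\<close>

lemma progressively_measurable_section:
  assumes X: "progressively_measurable T F X" and "0 < T"
    and filt: "normal_filtration M T F" and \<omega>: "\<omega> \<in> space M"
  shows "(\<lambda>t. X t \<omega>) \<in> borel_measurable (time_measure T)"
proof -
  have T: "T \<in> {0..T}" using \<open>0 < T\<close> by simp
  have "\<omega> \<in> space (F T)"
    using filt T \<omega> unfolding normal_filtration_def subalgebra_def by simp
  moreover have "(\<lambda>(s, \<omega>). X s \<omega>) \<in> borel_measurable (restrict_space borel {0..T} \<Otimes>\<^sub>M F T)"
    using X T unfolding progressively_measurable_def by blast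
  ultimately have "(\<lambda>t. X t \<omega>) \<in> borel_measurable (restrict_space borel {0..T})"
    using measurable_compose[OF measurable_Pair2'[of \<omega> "F T"]] by fastforce
  then have "(\<lambda>t. X t \<omega>) \<in> borel_measurable (restrict_space borel {0<..<T})"
    by (rule measurable_restrict_mono) auto
  then show ?thesis
    using measurable_cong_sets[OF sets_time_measure refl] by blast
qed

theorem theorem15:
  fixes M :: "'w measure" and T :: real and F :: "real \<Rightarrow> 'w measure"
    and \<iota> :: "'v::{real_inner,banach,second_countable_topology}
                \<Rightarrow>\<^sub>L 'h::{real_inner,banach,second_countable_topology}"
    and A :: "real \<Rightarrow> 'w \<Rightarrow> 'v \<Rightarrow>\<^sub>L ('v \<Rightarrow>\<^sub>L real)"
    and A_min A_max \<rho> :: "'w \<Rightarrow> real"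
    and f :: "real \<Rightarrow> 'w \<Rightarrow> 'v \<Rightarrow>\<^sub>L real" and u0 :: "'w \<Rightarrow> 'h"
    and u :: "'w \<Rightarrow> real \<Rightarrow> 'v"
    and Vh :: "'i \<Rightarrow> 'v set" and uh :: "'i \<Rightarrow> 'w \<Rightarrow> real \<Rightarrow> 'v"
    and \<alpha> \<beta> \<gamma> p \<rho>_max :: ennreal and c :: "'i \<Rightarrow> ennreal"
  assumes T: "0 < T"
    and prob: "prob_space M" "complete_measure M"
    and filt: "normal_filtration M T F"
    and triple: "gelfand_embedding \<iota>"
    and A_meas: "\<And>v. progressively_measurable T F (\<lambda>t \<omega>. blinfun_apply (A t \<omega>) v)"
    and A_bounds_meas: "A_min \<in> borel_measurable M" "A_max \<in> borel_measurable M"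
    and A_bounds_pos: "AE \<omega> in M. 0 < A_min \<omega>" "AE \<omega> in M. 0 < A_max \<omega>"
    and A_bounded: "AE \<omega> in M. \<forall>t\<in>{0..T}. \<forall>v w.
           \<bar>blinfun_apply (blinfun_apply (A t \<omega>) v) w\<bar> \<le> A_max \<omega> * norm v * norm w"
    and A_coercive: "AE \<omega> in M. \<forall>t\<in>{0..T}. \<forall>v.
           blinfun_apply (blinfun_apply (A t \<omega>) v) v \<ge> A_min \<omega> * (norm v)\<^sup>2"
    and \<rho>: "\<rho> = (\<lambda>\<omega>. A_max \<omega> / A_min \<omega>)"
    and f_meas: "progressively_measurable T F f"
    and f_L2: "\<And>\<omega>. \<omega> \<in> space M \<Longrightarrow> (\<lambda>t. f t \<omega>) \<in> L2_space T norm UNIV"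
    and u0_meas: "u0 \<in> borel_measurable M"
    and u: "AE \<omega> in M. weak_solution T \<iota> (\<lambda>t. A t \<omega>) (\<lambda>t. f t \<omega>) (u0 \<omega>) (u \<omega>)"
    and Vh: "\<And>h. subspace (Vh h)" "\<And>h. \<exists>B. finite B \<and> Vh h = span B" "\<And>h. Vh h \<noteq> {0}"
    and uh: "\<And>h. AE \<omega> in M.
           discrete_solution T \<iota> (\<lambda>t. A t \<omega>) (\<lambda>t. f t \<omega>) (u0 \<omega>) (Vh h) (uh h \<omega>)"
    and A_self_adjoint: "AE \<omega> in M. \<forall>t\<in>{0..T}. \<forall>v w.
           blinfun_apply (blinfun_apply (A t \<omega>) v) w = blinfun_apply (blinfun_apply (A t \<omega>) w) v"
    and exponents: "1 \<le> \<alpha>" "1 \<le> \<beta>" "1 \<le> \<gamma>"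
    and f_Lp: "(\<lambda>\<omega> t. f t \<omega>) \<in> Lp_space M \<alpha> (L2_norm T) (L2_space T norm UNIV)"
    and u0_Lp: "u0 \<in> Lp_space M \<beta> (\<lambda>z. ennreal (norm z)) UNIV"
    and A_min_Lp: "(\<lambda>\<omega>. inverse (A_min \<omega>)) \<in> Lp_space M \<gamma> (\<lambda>z. ennreal (norm z)) UNIV"
    and p: "p = min (exponent_quotient \<alpha> \<gamma>) (exponent_quotient \<beta> (2 * \<gamma>))" "1 < p"
    and c: "\<And>h. c h = dual_norm_ratio \<iota> (Vh h)" "\<And>h. c h < \<top>"
    and \<rho>_max: "\<rho>_max = (SUP \<omega>\<in>space M. ennreal \<bar>\<rho> \<omega>\<bar>)" "\<rho>_max < \<top>"
  shows "Lp_norm M p (\<lambda>\<omega>. L2_norm T (u \<omega> - uh h \<omega>))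
           \<le> c h * (1 + \<rho>_max) * expected_best_error M p T (L2_space T norm (Vh h)) u"
proof -
  let ?W = "Vh h"
  obtain B where B: "finite B" "?W = span B" using Vh(2) by blast
  have inj: "inj (blinfun_apply \<iota>)" using triple by (simp add: gelfand_embedding_def)
  obtain C where C: "dual_norm_ratio \<iota> ?W = ennreal C" "0 \<le> C"
    using c(1)[of h] c(2)[of h] by (metis ennreal_enn2real enn2real_nonneg)
  have C1: "1 \<le> C"
    using dual_norm_ratio_ge_1[OF Vh(1,3)[of h] inj] C by simp
  obtain R where R: "\<rho>_max = ennreal R" "0 \<le> R"
    using \<rho>_max(2) by (cases \<rho>_max) auto
  have \<rho>_le: "\<bar>A_max \<omega> / A_min \<omega>\<bar> \<le> R" if "\<omega> \<in> space M" for \<omega>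
  proof -
    have "ennreal \<bar>\<rho> \<omega>\<bar> \<le> \<rho>_max" unfolding \<rho>_max(1) using that by (rule SUP_upper)
    then show ?thesis using R by (simp add: \<rho>)
  qed
  define K where "K = C * (1 + R)"
  have K: "0 < K" unfolding K_def using C1 R(2) by (intro mult_pos_pos) auto
  \<comment> \<open>The exceptional set comes only from the hypotheses on the data and the two
    solutions, so it is fixed before \<open>y\<close>.\<close>
  have "AE \<omega> in M. \<forall>y\<in>Lp_space M p (L2_norm T) (L2_space T norm ?W).
      L2_norm T (u \<omega> - uh h \<omega>) \<le> ennreal K * L2_norm T (u \<omega> - y \<omega>)"
    using A_bounds_pos A_bounded A_coercive A_self_adjoint u uh[of h] AE_space
  proof eventually_elim
    case (elim \<omega>)
    interpret symmetric_form T \<iota> "\<lambda>t. A t \<omega>" "A_min \<omega>" "A_max \<omega>" ?W B C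
    proof
      show "(\<lambda>t. blinfun_apply (A t \<omega>) v) \<in> borel_measurable (time_measure T)" for v
        by (rule progressively_measurable_section[OF A_meas T filt]) (use elim in simp)
    qed (use elim inj B Vh(3) C C1 in auto)
    \<comment> \<open>The bound on \<rho> holds throughout the sample space, so one constant
      \<open>K\<close> serves almost every \<omega>.\<close>
    have "C * (1 + A_max \<omega> / A_min \<omega>) \<le> K"
      unfolding K_def using \<rho>_le[of \<omega>] elim C(2) by (intro mult_left_mono) auto
    then have le: "ennreal (C * (1 + A_max \<omega> / A_min \<omega>)) * x \<le> ennreal K * x" for x
      by (intro mult_right_mono ennreal_leI) auto
    show ?case
    proof
      fix y assume "y \<in> Lp_space M p (L2_norm T) (L2_space T norm ?W)"
      then have "y \<omega> \<in> L2_space T norm ?W"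
        using elim unfolding Lp_space_def by blast
      then show "L2_norm T (u \<omega> - uh h \<omega>) \<le> ennreal K * L2_norm T (u \<omega> - y \<omega>)"
        using order_trans[OF quasi_optimal le] elim by blast
    qed
  qed
  moreover have "emeasure M (space M) \<noteq> 0"
    using prob_space.emeasure_space_1[OF prob(1)] by simp
  moreover have "0 < p" using p(2) by (metis less_trans zero_less_one)
  moreover have "c h * (1 + \<rho>_max) = ennreal K"
    using C R by (simp add: c(1) K_def ennreal_mult ennreal_plus)
  ultimately show ?thesis
    using Lp_norm_le_expected_best_error[OF _ _ K] by simp
qed

end
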